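(* Let $H$ be a real Hilbert space and let the closed nonempty set $K\subset H$ be $r$-prox-regular for some $r>0$. Fix $p_0\in K_r$ and set $\bar x:=\operatorname{proj}_K(p_0)$. Let $j:=\frac12\|\cdot\|_H^2+\delta_K$. Then the following assertions are equivalent. (i) For all $\rho\in(\|p_0-\bar x\|_H,r)$, the function $j$ is strongly twice epi-differentiable in $\bar x$ for $p_0+(1-\frac\rho r)(p_0-\bar x)$. (ii) For some $\rho\in(\|p_0-\bar x\|_H,r)$, the function $j$ is strongly twice epi-differentiable in $\bar x$ for $p_0+(1-\frac\rho r)(p_0-\bar x)$. (iii) The projection $\operatorname{proj}_K$ is Hadamard directionally differentiable at $p_0$.
   Context: For $y\in H$, $\pi_K(y):=\{x\in K:\|x-y\|_H=\inf_{x'\in K}\|x'-y\|_H\}$. For $x\in K$ the proximal normal cone is $\mathcal N_K^P(x):=\{v\in H:\exists\lambda\ge0,\,y\in H\text{ with }x\in\pi_K(y)\text{ and }v=\lambda(y-x)\}$. $K$ is $r$-prox-regular if $$\tfrac12\|v\|_H\|x-\bar x\|_H^2\ge r\,(v,x-\bar x)_H\qquad\forall\bar x,x\in K,\ v\in\mathcal N_K^P(\bar x).$$ For $\rho>0$, $K_\rho:=\{y\in H:\exists x\in K,\ \|x-y\|_H<\rho\}$. It is a known fact that if $K$ is closed and $r$-prox-regular, then for each $\rho\in(0,r)$, $\pi_K$ is single-valued on $K_\rho$ and $\operatorname{proj}_K(y)$, the single element of $\pi_K(y)$, is Lipschitz continuous on $K_\rho$ with constant $r/(r-\rho)$; in particular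 $\operatorname{proj}_K$ is defined on $K_r$. $\delta_K$ is the indicator function of $K$ ($0$ on $K$, $+\infty$ elsewhere). For a proper function $j:H\to(-\infty,\infty]$, $x$ with $j(x)\in\mathbb R$ and $g\in H$, $$Q_j^{x,g}(z):=\inf\Big\{\liminf_{n\to\infty}\frac{j(x+t_nz_n)-j(x)-t_n(g,z_n)_H}{t_n^2/2}\ \Big|\ t_n\searrow0,\ z_n\rightharpoonup z\Big\}.$$ $j$ is strongly twice epi-differentiable in $x$ for $g$ if for every $z\in H$ and every $\{t_n\}\subset(0,\infty)$ with $t_n\searrow0$ there is $z_n\to z$ (in norm) with $Q_j^{x,g}(z)=\lim_{n\to\infty}\frac{j(x+t_nz_n)-j(x)-t_n(g,z_n)_H}{t_n^2/2}$. Hadamard directional differentiability at $p_0$: for every $q\in H$ there is $y\in H$ such that for every family $q_t\to q$ ($t\searrow0$) one has $(\operatorname{proj}_K(p_0+tq_t)-\operatorname{proj}_K(p_0))/t\to y$ in $H$. *)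

theory Defs
  imports "HOL-Analysis.Analysis"
begin

definition proj_set :: "'a::real_inner set \<Rightarrow> 'a \<Rightarrow> 'a set" where
  "proj_set K y = {x \<in> K. norm (x - y) = (INF x'\<in>K. norm (x' - y))}"

text \<open>Meaningful only where \<open>proj_set K y\<close> is a singleton.
  The library's \<open>closest_point\<close> requires a Heine-Borel space, so it cannot be used
  in a general Hilbert space.\<close>

definition proj :: "'a::real_inner set \<Rightarrow> 'a \<Rightarrow> 'a" where
  "proj K y = (THE x. x \<in> proj_set K y)"

definition prox_normal_cone :: "'a::real_inner set \<Rightarrow> 'a \<Rightarrow> 'a set" where
  "prox_normal_cone K x =
     {v. \<exists>c::real. \<exists>y. 0 \<le> c \<and> x \<in> proj_set K y \<and> v = c *\<^sub>R (y - x)}"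

definition prox_regular :: "real \<Rightarrow> 'a::real_inner set \<Rightarrow> bool" where
  "prox_regular r K \<longleftrightarrow>
     (\<forall>xbar\<in>K. \<forall>x\<in>K. \<forall>v\<in>prox_normal_cone K xbar.
        1 / 2 * norm v * (norm (x - xbar))\<^sup>2 \<ge> r * (v \<bullet> (x - xbar)))"

definition enlargement :: "'a::real_inner set \<Rightarrow> real \<Rightarrow> 'a set" where
  "enlargement K \<rho> = {y. \<exists>x\<in>K. norm (x - y) < \<rho>}"

definition indicator_fun :: "'a set \<Rightarrow> 'a \<Rightarrow> ereal" where
  "indicator_fun K x = (if x \<in> K then 0 else \<infinity>)"

text \<open>Positive null sequences; monotonicity is not required.\<close>

definition pos_null_seq :: "(nat \<Rightarrow> real) \<Rightarrow> bool" where
  "pos_null_seq t \<longleftrightarrow> (\<forall>n. 0 < t n) \<and> t \<longlonglongrightarrow> 0"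

definition weakly_converges :: "(nat \<Rightarrow> 'a::real_normed_vector) \<Rightarrow> 'a \<Rightarrow> bool" where
  "weakly_converges zs z \<longleftrightarrow>
     (\<forall>f :: 'a \<Rightarrow> real. bounded_linear f \<longrightarrow> (\<lambda>n. f (zs n)) \<longlonglongrightarrow> f z)"

definition second_diff_quot ::
    "('a::real_inner \<Rightarrow> ereal) \<Rightarrow> 'a \<Rightarrow> 'a \<Rightarrow> real \<Rightarrow> 'a \<Rightarrow> ereal" where
  "second_diff_quot j x g t z =
     (j (x + t *\<^sub>R z) - j x - ereal (t * (g \<bullet> z))) / ereal (t\<^sup>2 / 2)"

definition second_subderivative ::
    "('a::real_inner \<Rightarrow> ereal) \<Rightarrow> 'a \<Rightarrow> 'a \<Rightarrow> 'a \<Rightarrow> ereal" where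
  "second_subderivative j x g z =
     Inf {liminf (\<lambda>n. second_diff_quot j x g (t n) (zs n)) | t zs.
            pos_null_seq t \<and> weakly_converges zs z}"

definition strongly_twice_epi_differentiable ::
    "('a::real_inner \<Rightarrow> ereal) \<Rightarrow> 'a \<Rightarrow> 'a \<Rightarrow> bool" where
  "strongly_twice_epi_differentiable j x g \<longleftrightarrow>
     (\<forall>z t. pos_null_seq t \<longrightarrow>
        (\<exists>zs. zs \<longlonglongrightarrow> z \<and>
           (\<lambda>n. second_diff_quot j x g (t n) (zs n)) \<longlonglongrightarrow> second_subderivative j x g z))"

definition hadamard_dir_differentiable ::
    "('a::real_normed_vector \<Rightarrow> 'b::real_normed_vector) \<Rightarrow> 'a \<Rightarrow> bool" where
  "hadamard_dir_differentiable f p \<longleftrightarrow>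
     (\<forall>q. \<exists>y. \<forall>qt :: real \<Rightarrow> 'a. (qt \<longlongrightarrow> q) (at_right 0) \<longrightarrow>
        ((\<lambda>t. (f (p + t *\<^sub>R qt t) - f p) /\<^sub>R t) \<longlongrightarrow> y) (at_right 0))"

end

theory Submission
  imports Defs
begin

text \<open>Write \<open>v = p0 - xbar\<close>. Up to a constant, the projection of \<open>p0 + t q\<close> is
  \<open>xbar + t z\<close>, where \<open>z\<close> minimises the second-order difference quotient of \<open>j\<close> tilted by
  \<open>- 2 (q, z)\<close>, and prox-regularity makes these minimisers unique with uniform quadratic growth and
  Lipschitz dependence on \<open>q\<close>. Strong epi-convergence of the quotients therefore gives convergence
  of the minimisers (weak compactness provides the lower bound on the minimal values). Conversely,
  convergence of all the minimisers gives convergence of the minimal values, being the primitives of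
  the minimisers as functions of \<open>q\<close>; their limit is dual to a convex minorant of the second
  subderivative, which is attained along minimisers, so that no convexity of the quotients is needed.
  The parameter \<open>\<rho>\<close> replaces \<open>v\<close> by \<open>c v\<close> with \<open>c = 2 - \<rho> / r \<ge> 1\<close>
  and \<open>c \<parallel>v\<parallel> < r\<close>. Epi-differentiability passes from \<open>c v\<close> to \<open>v\<close> because
  the quotients differ by a factor and a continuous quadratic term, while differentiability of the
  projection passes from \<open>v\<close> to \<open>c v\<close> along the normal ray.\<close>

subsection \<open>Points with a projection are dense\<close>

lemma proj_set_iff:
  "x \<in> proj_set K y \<longleftrightarrow> x \<in> K \<and> (\<forall>x'\<in>K. norm (x - y) \<le> norm (x' - y))"
proof -
  have bdd: "bdd_below ((\<lambda>x'. norm (x' - y)) ` K)"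
    by (rule bdd_belowI[of _ 0]) auto
  show ?thesis
    unfolding proj_set_def
    by (auto intro!: antisym cINF_lower[OF bdd] cINF_greatest cINF_lower2[OF bdd])
qed

text \<open>Stewart's theorem for the point \<open>d *\<^sub>R b\<close> on the line through
  \<open>0\<close> and \<open>b\<close>; it compares distances before and after a base point is
  moved.\<close>

lemma norm_diff_scaleR_sq:
  fixes a b :: "'a::real_inner"
  shows "(norm (a - d *\<^sub>R b))\<^sup>2
    = (1 - d) * (norm a)\<^sup>2 + d * (norm (a - b))\<^sup>2 - d * (1 - d) * (norm b)\<^sup>2"
  unfolding power2_norm_eq_inner
  by (simp add: inner_simps inner_commute algebra_simps)

lemma near_projection:
  fixes K :: "'a::real_inner set"
  assumes "K \<noteq> {}" "e > 0"
  shows "\<exists>x\<in>K. \<forall>x'\<in>K. norm (x - y) \<le> norm (x' - y) + e"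
proof -
  have bdd: "bdd_below ((\<lambda>x'. norm (x' - y)) ` K)"
    by (rule bdd_belowI[of _ 0]) auto
  obtain x where x: "x \<in> K" "norm (x - y) < (INF x'\<in>K. norm (x' - y)) + e"
    using cINF_less_iff[OF assms(1) bdd, of "(INF x'\<in>K. norm (x' - y)) + e"] assms(2) by auto
  have "norm (x - y) \<le> norm (x' - y) + e" if "x' \<in> K" for x'
    using x(2) cINF_lower[OF bdd that] by simp
  then show ?thesis using x(1) by blast
qed

lemma geometric_steps_converge:
  fixes u :: "nat \<Rightarrow> 'a::{real_normed_vector, complete_space}"
  assumes step: "\<And>k. norm (u (Suc k) - u k) \<le> C * (1/2) ^ k"
  shows "\<exists>l. u \<longlonglongrightarrow> l \<and> norm (l - u 0) \<le> 2 * C"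
proof -
  \<comment> \<open>Subtracting the tail of the geometric series makes the induction close
    exactly.\<close>
  have bound: "norm (u (k + n) - u k) \<le> 2 * C * (1/2)^k - 2 * C * (1/2)^(k + n)" for k n
  proof (induction n)
    case (Suc n)
    have "norm (u (k + Suc n) - u k) \<le> norm (u (Suc (k + n)) - u (k + n)) + norm (u (k + n) - u k)"
      using norm_triangle_ineq[of "u (Suc (k + n)) - u (k + n)" "u (k + n) - u k"] by simp
    also have "\<dots> \<le> C * (1/2)^(k + n) + (2 * C * (1/2)^k - 2 * C * (1/2)^(k + n))"
      using step[of "k + n"] Suc by linarith
    finally show ?case by simp
  qed simp
  have C: "C \<ge> 0" using order_trans[OF norm_ge_zero step[of 0]] by simp
  have bound': "norm (u (k + n) - u k) \<le> 2 * C * (1/2)^k" for k n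
    using bound[of k n] C by (smt (verit) mult_nonneg_nonneg zero_le_power zero_le_divide_1_iff)
  have "Cauchy u"
  proof (rule metric_CauchyI)
    fix e :: real assume "e > 0"
    have "(\<lambda>k. 2 * C * (1/2::real)^k) \<longlonglongrightarrow> 0"
      by (intro tendsto_mult_right_zero LIMSEQ_power_zero) auto
    then have "\<forall>\<^sub>F k in sequentially. 2 * C * (1/2::real)^k < e / 2"
      by (rule order_tendstoD) (use \<open>e > 0\<close> in simp)
    then obtain N where N: "2 * C * (1/2::real)^N < e / 2"
      by (auto simp: eventually_sequentially)
    have "dist (u m) (u N) < e / 2" if "m \<ge> N" for m
      using bound'[of N "m - N"] N that by (simp add: dist_norm)
    then show "\<exists>M. \<forall>m\<ge>M. \<forall>n\<ge>M. dist (u m) (u n) < e"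
      by (meson dist_triangle_half_l)
  qed
  then obtain l where l: "u \<longlonglongrightarrow> l" using Cauchy_convergent convergent_def by blast
  have "(\<lambda>n. norm (u n - u 0)) \<longlonglongrightarrow> norm (l - u 0)" by (intro tendsto_intros l)
  then have "norm (l - u 0) \<le> 2 * C"
    by (rule LIMSEQ_le_const2) (use bound'[of 0] in auto)
  with l show ?thesis by blast
qed

text \<open>Moving \<open>y\<close> slightly towards an almost nearest point \<open>x\<close> forces every almost nearest point
  of the moved \<open>y\<close> to lie close to \<open>x\<close>; iterating this with geometrically decreasing tolerances
  makes both sequences converge.\<close>

lemma dense_proj_set_nonempty:
  fixes K :: "'a::{real_inner, complete_space} set"
  assumes "closed K" "K \<noteq> {}" "e > 0"
  shows "\<exists>y' x. norm (y' - y) < e \<and> x \<in> proj_set K y'"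
proof -
  obtain a0 where a0: "a0 \<in> K" "\<forall>x'\<in>K. norm (a0 - y) \<le> norm (x' - y) + 1"
    using near_projection[OF assms(2), of 1 y] by auto
  define B where "B = norm (a0 - y) + 2"
  have B: "B > 0" unfolding B_def by (smt (verit) norm_ge_zero)
  \<comment> \<open>The total displacement of the base point is at most \<open>2 * (d * B)\<close>,
    which this choice keeps below \<open>e\<close>; \<open>d \<le> 1/2\<close> keeps each move on
    the segment towards \<open>x\<close>.\<close>
  define d where "d = min (1/2) (e / (4 * B))"
  have d: "0 < d" "d \<le> 1/2" "d * B \<le> e / 4"
    using B assms(3) by (auto simp: d_def min_def field_simps)
  \<comment> \<open>Invariant of stage \<open>k\<close>: \<open>x\<close> is nearest to
    \<open>z\<close> up to \<open>(1/16) ^ k\<close>. The increasing budget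
    \<open>B - (1/16) ^ k\<close> absorbs the later tolerances, so all distances stay below
    \<open>B\<close>.\<close>
  define S where "S = (\<lambda>k (x, z). x \<in> K \<and> (\<forall>x'\<in>K. norm (x - z) \<le> norm (x' - z) + (1/16) ^ k)
     \<and> norm (x - z) \<le> B - (1/16) ^ k \<and> (k = 0 \<longrightarrow> z = y))"
  define R where "R = (\<lambda>k (x, z) (x', z'). z' = z + (d * (1/2)^k) *\<^sub>R (x - (z::'a)) \<and> x' = (x'::'a))"
  have "\<exists>f. \<forall>k. S k (f k) \<and> R k (f k) (f (Suc k))"
  proof (rule dependent_nat_choice)
    show "\<exists>p. S 0 p"
      using a0 by (intro exI[of _ "(a0, y)"]) (auto simp: S_def B_def)
  next
    fix p k assume Sp: "S k p"
    obtain x z where p: "p = (x, z)" by force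
    let ?z = "z + (d * (1/2)^k) *\<^sub>R (x - z)"
    obtain x1 where x1: "x1 \<in> K" "\<forall>x'\<in>K. norm (x1 - ?z) \<le> norm (x' - ?z) + (1/16) ^ Suc k"
      using near_projection[OF assms(2), of "(1/16) ^ Suc k" ?z] by auto
    have dk: "0 \<le> d * (1/2)^k" "d * (1/2)^k \<le> 1"
      using d by (auto intro!: mult_le_one power_le_one)
    have "x - ?z = (1 - d * (1/2)^k) *\<^sub>R (x - z)" by (simp add: algebra_simps)
    then have "norm (x - ?z) = \<bar>1 - d * (1/2)^k\<bar> * norm (x - z)" by (simp only: norm_scaleR)
    also have "\<dots> \<le> norm (x - z)" using dk by (intro mult_left_le_one_le) auto
    finally have "norm (x - ?z) \<le> norm (x - z)" .
    moreover have "norm (x1 - ?z) \<le> norm (x - ?z) + (1/16) ^ Suc k"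
      using x1 Sp p by (auto simp: S_def)
    ultimately have "norm (x1 - ?z) \<le> B - (1/16) ^ k + (1/16) ^ Suc k"
      using Sp p by (auto simp: S_def)
    also have "\<dots> \<le> B - (1/16) ^ Suc k" by simp
    finally have "S (Suc k) (x1, ?z)" using x1 by (simp add: S_def)
    then show "\<exists>q. S (Suc k) q \<and> R k p q"
      using p by (intro exI[of _ "(x1, ?z)"]) (auto simp: R_def)
  qed
  then obtain f where f: "\<And>k. S k (f k)" "\<And>k. R k (f k) (f (Suc k))" by blast
  define X Y where "X k = fst (f k)" and "Y k = snd (f k)" for k
  have X: "X k \<in> K" "\<And>x'. x' \<in> K \<Longrightarrow> norm (X k - Y k) \<le> norm (x' - Y k) + (1/16) ^ k"
    "norm (X k - Y k) \<le> B - (1/16) ^ k" for k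
    using f(1)[of k] by (auto simp: S_def X_def Y_def split: prod.splits)
  have XB: "norm (X k - Y k) \<le> B" for k
    using X(3)[of k] by (smt (verit) zero_le_divide_1_iff zero_le_power)
  have Y0: "Y 0 = y" using f(1)[of 0] by (auto simp: S_def Y_def split: prod.splits)
  have Y: "Y (Suc k) = Y k + (d * (1/2)^k) *\<^sub>R (X k - Y k)" for k
    using f(2)[of k] by (auto simp: R_def X_def Y_def split: prod.splits)
  have "norm (Y (Suc k) - Y k) \<le> (d * B) * (1/2) ^ k" for k
    using XB[of k] d by (simp add: Y mult_left_mono)
  then obtain y' where y': "Y \<longlonglongrightarrow> y'" "norm (y' - y) \<le> 2 * (d * B)"
    using geometric_steps_converge[of Y "d * B"] Y0 by auto
  \<comment> \<open>The squared step of \<open>X\<close> will be at most tolerance over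
    displacement, \<open>(4 * B + 1) * (1/16) ^ k / (d * (1/2) ^ k)\<close>, which is
    \<open>C\<^sup>2 * (1/8) ^ k\<close>. This is why the tolerances shrink faster than the
    displacements.\<close>
  define C where "C = sqrt ((4 * B + 1) / d)"
  have "norm (X (Suc k) - X k) \<le> C * (1/2) ^ k" for k
  proof -
    define \<delta> \<eta> b where "\<delta> = d * (1/2)^k" and "\<eta> = (1/16::real)^k" and "b = norm (X k - Y k)"
    have \<delta>: "0 < \<delta>" "\<delta> \<le> 1" unfolding \<delta>_def using d by (auto intro!: mult_le_one power_le_one)
    have \<eta>: "0 < \<eta>" "\<eta> \<le> 1" unfolding \<eta>_def by (auto intro!: power_le_one)
    have b: "0 \<le> b" "b \<le> B" using XB by (auto simp: b_def)
    have *: "X k - Y (Suc k) = (1 - \<delta>) *\<^sub>R (X k - Y k)" by (simp add: Y \<delta>_def algebra_simps)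
    have 1: "norm (X k - Y (Suc k)) = (1 - \<delta>) * b"
      unfolding * b_def using \<delta> by simp
    have "norm (X (Suc k) - Y (Suc k)) \<le> (1 - \<delta>) * b + \<eta> / 16"
      using X(2)[OF X(1)[of k], of "Suc k"] by (simp add: 1 \<eta>_def)
    then have "(norm (X (Suc k) - Y (Suc k)))\<^sup>2 \<le> ((1 - \<delta>) * b + \<eta> / 16)\<^sup>2"
      by (intro power_mono) auto
    also have "\<dots> = (1 - \<delta>)\<^sup>2 * b\<^sup>2 + ((1 - \<delta>) * b) * \<eta> / 8 + \<eta> * \<eta> / 256"
      by (simp add: power2_eq_square field_simps)
    also have "\<dots> \<le> (1 - \<delta>)\<^sup>2 * b\<^sup>2 + B * \<eta> / 8 + \<eta> / 256"
    proof -
      have "(1 - \<delta>) * b \<le> B" using b \<delta> by (smt (verit) mult_left_le_one_le)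
      then have "((1 - \<delta>) * b) * \<eta> \<le> B * \<eta>" using \<eta> by (intro mult_right_mono) auto
      moreover have "\<eta> * \<eta> \<le> \<eta>" using \<eta> by (simp add: mult_left_le)
      ultimately show ?thesis by simp
    qed
    finally have 2: "(norm (X (Suc k) - Y (Suc k)))\<^sup>2 \<le> (1 - \<delta>)\<^sup>2 * b\<^sup>2 + B * \<eta> / 8 + \<eta> / 256" .
    have 3: "b \<le> norm (X (Suc k) - Y k) + \<eta>"
      using X(2)[OF X(1)[of "Suc k"], of k] by (simp add: b_def \<eta>_def)
    \<comment> \<open>Squaring 3 needs \<open>b - \<eta>\<close> to be nonnegative; in the other
      case the right-hand side is not positive.\<close>
    have 4: "(norm (X (Suc k) - Y k))\<^sup>2 \<ge> b\<^sup>2 - 2 * \<eta> * b"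
    proof (cases "b \<le> \<eta>")
      case True
      then have "b * b \<le> \<eta> * b" using b by (intro mult_right_mono)
      moreover have "0 \<le> \<eta> * b" using b \<eta> by simp
      moreover have "0 \<le> (norm (X (Suc k) - Y k))\<^sup>2" by simp
      ultimately show ?thesis unfolding power2_eq_square[of b] by linarith
    next
      case False
      then have "(b - \<eta>)\<^sup>2 \<le> (norm (X (Suc k) - Y k))\<^sup>2" using 3 by (intro power_mono) auto
      moreover have "(b - \<eta>)\<^sup>2 = b\<^sup>2 - 2 * \<eta> * b + \<eta>\<^sup>2" by (simp add: power2_diff)
      moreover have "0 \<le> \<eta>\<^sup>2" by simp
      ultimately show ?thesis by linarith
    qed
    have "X (Suc k) - Y (Suc k) = (X (Suc k) - Y k) - \<delta> *\<^sub>R (X k - Y k)"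
      by (simp add: Y \<delta>_def)
    \<comment> \<open>Combined with 2 and 4, the terms
      \<open>(1 - \<delta>)\<^sup>2 * b\<^sup>2\<close> cancel, leaving \<open>\<delta>\<close>
      times the squared step against tolerances alone.\<close>
    then have 5: "(norm (X (Suc k) - Y (Suc k)))\<^sup>2
      = (1 - \<delta>) * (norm (X (Suc k) - Y k))\<^sup>2 + \<delta> * (norm (X (Suc k) - X k))\<^sup>2 - \<delta> * (1 - \<delta>) * b\<^sup>2"
      using norm_diff_scaleR_sq[of "X (Suc k) - Y k" \<delta> "X k - Y k"]
      by (simp only: b_def diff_diff_eq2 diff_add_cancel)
    have "(1 - \<delta>) * (b\<^sup>2 - 2 * \<eta> * b) \<le> (1 - \<delta>) * (norm (X (Suc k) - Y k))\<^sup>2"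
      using 4 \<delta> by (intro mult_left_mono) auto
    then have "\<delta> * (norm (X (Suc k) - X k))\<^sup>2 \<le> B * \<eta> / 8 + \<eta> / 256 + (1 - \<delta>) * (2 * \<eta> * b)"
      using 2 5 by (simp add: algebra_simps power2_eq_square)
    also have "(1 - \<delta>) * (2 * \<eta> * b) \<le> 2 * \<eta> * B"
    proof -
      have "(1 - \<delta>) * (2 * \<eta> * b) \<le> 2 * \<eta> * b"
        using b \<delta> \<eta> by (intro mult_left_le_one_le) auto
      also have "\<dots> \<le> 2 * \<eta> * B" using b \<eta> by (intro mult_left_mono) auto
      finally show ?thesis .
    qed
    finally have 6: "\<delta> * (norm (X (Suc k) - X k))\<^sup>2 \<le> (4 * B + 1) * \<eta>"
      using mult_pos_pos[OF B \<eta>(1)] \<eta>(1) by (simp add: algebra_simps)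
    have "(norm (X (Suc k) - X k))\<^sup>2 \<le> (4 * B + 1) * \<eta> / \<delta>"
      using 6 \<delta> by (simp add: field_simps)
    also have "\<eta> = (1/8)^k * (1/2)^k"
      unfolding \<eta>_def power_mult_distrib[symmetric] by simp
    also have "(4 * B + 1) * ((1/8)^k * (1/2)^k) / \<delta> = (4 * B + 1) / d * (1/8)^k"
      unfolding \<delta>_def using d by simp
    also have "\<dots> \<le> (4 * B + 1) / d * (1/4)^k"
      using B d by (intro mult_left_mono power_mono) auto
    also have "\<dots> = (C * (1/2)^k)\<^sup>2"
    proof -
      have "C\<^sup>2 = (4 * B + 1) / d" unfolding C_def using B d by (intro real_sqrt_pow2) simp
      moreover have "((1/2::real)^k)\<^sup>2 = (1/4)^k"
        unfolding power2_eq_square power_mult_distrib[symmetric] by simp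
      ultimately show ?thesis by (simp only: power_mult_distrib)
    qed
    finally show ?thesis
      by (rule power2_le_imp_le) (use B d in \<open>simp add: C_def\<close>)
  qed
  then obtain x where x: "X \<longlonglongrightarrow> x"
    using geometric_steps_converge[of X C] by auto
  have "x \<in> K" using closed_sequentially[OF assms(1) _ x] X(1) by auto
  moreover have "norm (x - y') \<le> norm (x' - y')" if "x' \<in> K" for x'
  proof -
    have l1: "(\<lambda>k. norm (X k - Y k)) \<longlonglongrightarrow> norm (x - y')" by (intro tendsto_intros x y')
    have "(\<lambda>k. norm (x' - Y k) + (1/16) ^ k) \<longlonglongrightarrow> norm (x' - y') + 0"
      by (intro tendsto_intros y' LIMSEQ_power_zero) auto
    from LIMSEQ_le[OF l1 this] show ?thesis using X(2)[OF that] by auto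
  qed
  ultimately have "x \<in> proj_set K y'" by (simp add: proj_set_iff)
  moreover have "norm (y' - y) < e" using y'(2) d(3) assms(3) by linarith
  ultimately show ?thesis by blast
qed

subsection \<open>Prox-regular sets\<close>

lemma proj_eqI:
  assumes "x \<in> proj_set K y" "\<And>x'. x' \<in> proj_set K y \<Longrightarrow> x' = x"
  shows "proj K y = x"
  unfolding proj_def using assms by blast

locale prox_regular_set =
  fixes K :: "'a::{real_inner, complete_space} set" and r :: real
  assumes closed_K: "closed K" and K_nonempty: "K \<noteq> {}"
    and r_pos: "0 < r" and prox_regular: "prox_regular r K"
begin

lemma prox_normal_ineq:
  assumes "x \<in> proj_set K y" "x' \<in> K"
  shows "2 * r * ((y - x) \<bullet> (x' - x)) \<le> norm (y - x) * (norm (x' - x))\<^sup>2"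
proof -
  have "y - x \<in> prox_normal_cone K x"
    unfolding prox_normal_cone_def using assms(1) by (auto intro!: exI[of _ 1] exI[of _ y])
  moreover have "x \<in> K" using assms(1) by (simp add: proj_set_iff)
  ultimately have "1 / 2 * norm (y - x) * (norm (x' - x))\<^sup>2 \<ge> r * ((y - x) \<bullet> (x' - x))"
    using prox_regular assms(2) unfolding prox_regular_def by blast
  then show ?thesis by simp
qed

text \<open>Expanding the square about \<open>x\<close> leaves a cross term that prox-regularity
  absorbs into the quadratic one. The growth coefficient is positive as long as the ray point is
  closer than \<open>r\<close> to \<open>x\<close>.\<close>

lemma ray_quadratic_growth:
  assumes "x \<in> proj_set K y" "x' \<in> K" "0 \<le> c"
  shows "(norm (x' - (x + c *\<^sub>R (y - x))))\<^sup>2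
    \<ge> (norm (c *\<^sub>R (y - x)))\<^sup>2 + (1 - norm (c *\<^sub>R (y - x)) / r) * (norm (x' - x))\<^sup>2"
proof -
  have "2 * ((y - x) \<bullet> (x' - x)) \<le> norm (y - x) * (norm (x' - x))\<^sup>2 / r"
    using prox_normal_ineq[OF assms(1,2)] r_pos by (simp add: field_simps)
  then have "c * (2 * ((y - x) \<bullet> (x' - x))) \<le> c * (norm (y - x) * (norm (x' - x))\<^sup>2 / r)"
    using assms(3) by (rule mult_left_mono)
  moreover have "(norm (x' - (x + c *\<^sub>R (y - x))))\<^sup>2
    = (norm (x' - x))\<^sup>2 - c * (2 * ((y - x) \<bullet> (x' - x))) + (norm (c *\<^sub>R (y - x)))\<^sup>2"
    unfolding power2_norm_eq_inner by (simp add: inner_simps inner_commute algebra_simps)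
  moreover have "(1 - norm (c *\<^sub>R (y - x)) / r) * (norm (x' - x))\<^sup>2
    = (norm (x' - x))\<^sup>2 - c * (norm (y - x) * (norm (x' - x))\<^sup>2 / r)"
    unfolding norm_scaleR using assms(3) by (simp add: left_diff_distrib)
  ultimately show ?thesis by linarith
qed

text \<open>The growth coefficient stays nonnegative up to distance \<open>r\<close>, so for
  \<open>c > 1\<close> the projection persists beyond \<open>y\<close>.\<close>

lemma proj_set_ray:
  assumes "x \<in> proj_set K y" "0 \<le> c" "c * norm (y - x) \<le> r"
  shows "x \<in> proj_set K (x + c *\<^sub>R (y - x))"
  unfolding proj_set_iff
proof (intro conjI ballI)
  show "x \<in> K" using assms(1) by (simp add: proj_set_iff)
  fix x' assume "x' \<in> K"
  have "0 \<le> 1 - norm (c *\<^sub>R (y - x)) / r"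
    unfolding norm_scaleR using assms r_pos by simp
  then have "(norm (c *\<^sub>R (y - x)))\<^sup>2 \<le> (norm (x' - (x + c *\<^sub>R (y - x))))\<^sup>2"
    using ray_quadratic_growth[OF assms(1) \<open>x' \<in> K\<close> assms(2)]
    by (smt (verit) mult_nonneg_nonneg zero_le_power2)
  then have "norm (c *\<^sub>R (y - x)) \<le> norm (x' - (x + c *\<^sub>R (y - x)))"
    by (rule power2_le_imp_le) simp
  moreover have "x - (x + c *\<^sub>R (y - x)) = - (c *\<^sub>R (y - x))" by simp
  ultimately show "norm (x - (x + c *\<^sub>R (y - x))) \<le> norm (x' - (x + c *\<^sub>R (y - x)))"
    by (simp only: norm_minus_cancel)
qed

text \<open>Sum of the two normal inequalities, each tested with the projection of the other point;
  Cauchy-Schwarz then yields the Lipschitz estimate.\<close>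

lemma proj_set_cocoercive:
  assumes "x1 \<in> proj_set K y1" "x2 \<in> proj_set K y2" "norm (y1 - x1) \<le> \<rho>" "norm (y2 - x2) \<le> \<rho>"
  shows "(r - \<rho>) * (norm (x1 - x2))\<^sup>2 \<le> r * ((y1 - y2) \<bullet> (x1 - x2))"
proof -
  have K: "x1 \<in> K" "x2 \<in> K" using assms(1,2) by (simp_all add: proj_set_iff)
  have sq: "(norm (x2 - x1))\<^sup>2 = (norm (x1 - x2))\<^sup>2" by (simp add: norm_minus_commute)
  have "2 * r * ((y1 - x1) \<bullet> (x2 - x1)) \<le> \<rho> * (norm (x1 - x2))\<^sup>2"
    using order_trans[OF prox_normal_ineq[OF assms(1) K(2)] mult_right_mono[OF assms(3)]] sq by simp
  moreover have "2 * r * ((y2 - x2) \<bullet> (x1 - x2)) \<le> \<rho> * (norm (x1 - x2))\<^sup>2"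
    using order_trans[OF prox_normal_ineq[OF assms(2) K(1)] mult_right_mono[OF assms(4)]] by simp
  moreover have "2 * r * ((y1 - x1) \<bullet> (x2 - x1)) + 2 * r * ((y2 - x2) \<bullet> (x1 - x2))
    = 2 * r * (norm (x1 - x2))\<^sup>2 - 2 * (r * ((y1 - y2) \<bullet> (x1 - x2)))"
    unfolding power2_norm_eq_inner by (simp add: inner_simps inner_commute algebra_simps)
  ultimately show ?thesis by (simp add: algebra_simps)
qed

lemma proj_set_lipschitz:
  assumes "x1 \<in> proj_set K y1" "x2 \<in> proj_set K y2" "norm (y1 - x1) \<le> \<rho>" "norm (y2 - x2) \<le> \<rho>" "\<rho> < r"
  shows "norm (x1 - x2) \<le> r / (r - \<rho>) * norm (y1 - y2)"
proof (cases "x1 = x2")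
  case True
  then show ?thesis using r_pos assms(5) by simp
next
  case False
  have "(r - \<rho>) * norm (x1 - x2) * norm (x1 - x2) \<le> r * norm (y1 - y2) * norm (x1 - x2)"
    using proj_set_cocoercive[OF assms(1-4)]
      mult_left_mono[OF norm_cauchy_schwarz[of "y1 - y2" "x1 - x2"], of r] r_pos
    by (simp add: power2_eq_square algebra_simps)
  then have "(r - \<rho>) * norm (x1 - x2) \<le> r * norm (y1 - y2)" using False by simp
  then show ?thesis using assms(5) by (simp add: field_simps)
qed

lemma proj_set_unique:
  assumes "x1 \<in> proj_set K y" "x2 \<in> proj_set K y" "norm (y - x1) < r"
  shows "x1 = x2"
proof -
  have "norm (x1 - y) = norm (x2 - y)" using assms(1,2) by (auto simp: proj_set_iff intro: antisym)
  then have "norm (y - x2) = norm (y - x1)" by (simp add: norm_minus_commute)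
  then have "norm (x1 - x2) \<le> r / (r - norm (y - x1)) * norm (y - y)"
    using assms by (intro proj_set_lipschitz) auto
  then show ?thesis by simp
qed

lemma proj_eq:
  assumes "x \<in> proj_set K y" "norm (y - x) < r"
  shows "proj K y = x"
  using proj_eqI[OF assms(1)] proj_set_unique[OF assms(1) _ assms(2)] by auto

lemma proj_set_norm_less:
  assumes "x \<in> proj_set K y" "y \<in> enlargement K \<rho>"
  shows "norm (y - x) < \<rho>"
  using assms by (force simp: proj_set_iff enlargement_def norm_minus_commute[of y])

text \<open>Points with a projection are dense, and along such points tending to \<open>y\<close>
  the projections are Cauchy by the Lipschitz estimate. Their limit is a projection of
  \<open>y\<close>.\<close>

lemma proj_set_nonempty:
  assumes "y \<in> enlargement K r"
  shows "\<exists>x. x \<in> proj_set K y"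
proof -
  obtain a where a: "a \<in> K" "norm (a - y) < r" using assms by (auto simp: enlargement_def)
  \<comment> \<open>A bound strictly below \<open>r\<close> gives one Lipschitz constant for all
    approximants; \<open>\<rho> - norm (a - y)\<close> is the room left for perturbing
    \<open>y\<close>.\<close>
  define \<rho> where "\<rho> = (norm (a - y) + r) / 2"
  have \<rho>: "norm (a - y) < \<rho>" "\<rho> < r" using a by (auto simp: \<rho>_def)
  have "\<exists>p. norm (snd p - y) < (\<rho> - norm (a - y)) * inverse (Suc n) \<and> fst p \<in> proj_set K (snd p)" for n
    using dense_proj_set_nonempty[OF closed_K K_nonempty, of "(\<rho> - norm (a - y)) * inverse (Suc n)" y] \<rho>
    by auto
  then obtain p where p: "\<And>n. norm (snd (p n) - y) < (\<rho> - norm (a - y)) * inverse (Suc n)"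
    "\<And>n. fst (p n) \<in> proj_set K (snd (p n))" by metis
  have "(\<lambda>n. snd (p n) - y) \<longlonglongrightarrow> 0"
  proof (rule Lim_null_comparison)
    show "\<forall>\<^sub>F n in sequentially. norm (snd (p n) - y) \<le> (\<rho> - norm (a - y)) * inverse (Suc n)"
      using p(1) by (auto intro: less_imp_le always_eventually)
    show "(\<lambda>n. (\<rho> - norm (a - y)) * inverse (Suc n)) \<longlonglongrightarrow> 0"
      by (intro tendsto_mult_right_zero LIMSEQ_inverse_real_of_nat)
  qed
  then have lim_y: "(\<lambda>n. snd (p n)) \<longlonglongrightarrow> y" using Lim_null by blast
  have near: "norm (snd (p n) - fst (p n)) \<le> \<rho>" for n
  proof -
    have "(\<rho> - norm (a - y)) * inverse (real (Suc n)) \<le> \<rho> - norm (a - y)"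
      using \<rho> by (intro mult_left_le) (auto simp: inverse_le_1_iff)
    then have "norm (snd (p n) - y) < \<rho> - norm (a - y)" using p(1)[of n] by linarith
    then have "norm (a - snd (p n)) < \<rho>"
      using norm_triangle_ineq[of "a - y" "y - snd (p n)"] by (simp add: norm_minus_commute)
    then show ?thesis using p(2)[of n] a(1) by (force simp: proj_set_iff norm_minus_commute)
  qed
  have "Cauchy (\<lambda>n. fst (p n))"
  proof (rule metric_CauchyI)
    fix e :: real assume "e > 0"
    then have "e * (r - \<rho>) / r > 0" using \<rho> r_pos by simp
    then obtain M where M: "\<And>m n. m \<ge> M \<Longrightarrow> n \<ge> M \<Longrightarrow> dist (snd (p m)) (snd (p n)) < e * (r - \<rho>) / r"
      using LIMSEQ_imp_Cauchy[OF lim_y] metric_CauchyD by blast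
    have "dist (fst (p m)) (fst (p n)) < e" if "m \<ge> M" "n \<ge> M" for m n
    proof -
      have "r / (r - \<rho>) * dist (snd (p m)) (snd (p n)) < r / (r - \<rho>) * (e * (r - \<rho>) / r)"
        using M[OF that] \<rho> r_pos by (intro mult_strict_left_mono) auto
      also have "\<dots> = e" using \<rho> r_pos by simp
      finally show ?thesis
        using proj_set_lipschitz[OF p(2) p(2) near near \<rho>(2), of m n] by (simp add: dist_norm)
    qed
    then show "\<exists>M. \<forall>m\<ge>M. \<forall>n\<ge>M. dist (fst (p m)) (fst (p n)) < e" by blast
  qed
  then obtain x where x: "(\<lambda>n. fst (p n)) \<longlonglongrightarrow> x" using Cauchy_convergent convergent_def by blast
  have "x \<in> K" using closed_sequentially[OF closed_K _ x] p(2) by (simp add: proj_set_iff)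
  moreover have "norm (x - y) \<le> norm (x' - y)" if "x' \<in> K" for x'
  proof (rule LIMSEQ_le)
    show "(\<lambda>n. norm (fst (p n) - snd (p n))) \<longlonglongrightarrow> norm (x - y)" by (intro tendsto_intros x lim_y)
    show "(\<lambda>n. norm (x' - snd (p n))) \<longlonglongrightarrow> norm (x' - y)" by (intro tendsto_intros lim_y)
    show "\<exists>N. \<forall>n\<ge>N. norm (fst (p n) - snd (p n)) \<le> norm (x' - snd (p n))"
      using p(2) that by (auto simp: proj_set_iff)
  qed
  ultimately show ?thesis by (auto simp: proj_set_iff)
qed

lemma proj_in_proj_set:
  assumes "y \<in> enlargement K r"
  shows "proj K y \<in> proj_set K y"
  using proj_set_nonempty[OF assms] proj_eq proj_set_norm_less[OF _ assms] by metis

end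

subsection \<open>Weak compactness\<close>

lemma subspace_closure:
  fixes S :: "'a::real_normed_vector set"
  assumes "subspace S"
  shows "subspace (closure S)"
  unfolding subspace_def
proof (intro conjI ballI allI)
  show "0 \<in> closure S" using subspace_0[OF assms] closure_subset by blast
next
  fix x y assume "x \<in> closure S" "y \<in> closure S"
  then obtain f g where "\<And>n. f n \<in> S" "f \<longlonglongrightarrow> x" "\<And>n. g n \<in> S" "g \<longlonglongrightarrow> y"
    unfolding closure_sequential by blast
  then show "x + y \<in> closure S"
    unfolding closure_sequential
    by (intro exI[of _ "\<lambda>n. f n + g n"]) (simp add: subspace_add[OF assms] tendsto_add)
next
  fix c :: real and x assume "x \<in> closure S"
  then obtain f where "\<And>n. f n \<in> S" "f \<longlonglongrightarrow> x"
    unfolding closure_sequential by blast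
  then show "c *\<^sub>R x \<in> closure S"
    unfolding closure_sequential
    by (intro exI[of _ "\<lambda>n. c *\<^sub>R f n"]) (simp add: subspace_scale[OF assms] tendsto_scaleR)
qed

text \<open>Proximal normals to a subspace are orthogonal to it, so a subspace is prox-regular for
  every radius and the existence of nearest points just proved applies.\<close>

lemma closed_subspace_orthogonal_projection:
  fixes S :: "'a::{real_inner, complete_space} set"
  assumes "closed S" "subspace S"
  shows "\<exists>s\<in>S. \<forall>u\<in>S. (w - s) \<bullet> u = 0"
proof -
  have S: "convex S" "S \<noteq> {}" using assms(2) subspace_imp_convex subspace_0 by auto
  have orth: "(y - x) \<bullet> u = 0" if x: "x \<in> proj_set S y" and u: "u \<in> S" for x y u
  proof -
    have xS: "x \<in> S" "\<forall>z\<in>S. dist y x \<le> dist y z"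
      using x by (auto simp: proj_set_iff dist_norm norm_minus_commute)
    show ?thesis
      using any_closest_point_dot[OF S(1) assms(1) xS(1) _ xS(2), of "x + u"]
        any_closest_point_dot[OF S(1) assms(1) xS(1) _ xS(2), of "x - u"]
        subspace_add[OF assms(2) xS(1) u] subspace_diff[OF assms(2) xS(1) u]
      by simp
  qed
  \<comment> \<open>Any radius exceeding \<open>norm w\<close> would do: it puts \<open>w\<close> in
    the enlargement because \<open>0\<close> belongs to \<open>S\<close>.\<close>
  define r where "r = norm w + 1"
  have "prox_regular r S"
    unfolding prox_regular_def
  proof (intro ballI)
    fix xb x v assume *: "xb \<in> S" "x \<in> S" "v \<in> prox_normal_cone S xb"
    then obtain c y where "xb \<in> proj_set S y" "v = c *\<^sub>R (y - xb)" by (auto simp: prox_normal_cone_def)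
    then have "v \<bullet> (x - xb) = 0" using orth[of xb y "x - xb"] subspace_diff[OF assms(2) *(2,1)] by simp
    then show "1 / 2 * norm v * (norm (x - xb))\<^sup>2 \<ge> r * (v \<bullet> (x - xb))" by simp
  qed
  moreover have "r > 0" unfolding r_def by (smt (verit) norm_ge_zero)
  ultimately interpret prox_regular_set S r using S assms by unfold_locales
  have "w \<in> enlargement S r"
    unfolding enlargement_def r_def using subspace_0[OF assms(2)] by (auto intro!: bexI[of _ 0])
  then obtain s where s: "s \<in> proj_set S w" using proj_set_nonempty by blast
  then show ?thesis using orth[OF s] by (auto simp: proj_set_iff)
qed

text \<open>The representative is a multiple of a vector \<open>e\<close> orthogonal to the kernel,
  since \<open>w - (f w / f e) *\<^sub>R e\<close> always lies in the kernel.\<close>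

lemma riesz_representation:
  fixes f :: "'a::{real_inner, complete_space} \<Rightarrow> real"
  assumes "bounded_linear f"
  shows "\<exists>y. \<forall>w. f w = y \<bullet> w"
proof (cases "\<forall>w. f w = 0")
  case False
  interpret bounded_linear f by fact
  obtain u where u: "f u \<noteq> 0" using False by blast
  have "subspace {w. f w = 0}" by (auto simp: subspace_def add scaleR zero)
  moreover have "closed {w. f w = 0}"
    by (intro closed_Collect_eq continuous_on continuous_on_id continuous_on_const)
  ultimately obtain s where s: "f s = 0" "\<And>n. f n = 0 \<Longrightarrow> (u - s) \<bullet> n = 0"
    using closed_subspace_orthogonal_projection by blast
  define e where "e = u - s"
  have fe: "f e \<noteq> 0" using u s by (simp add: e_def diff)
  then have "e \<noteq> 0" using zero by auto
  have "f w = ((f e / (e \<bullet> e)) *\<^sub>R e) \<bullet> w" for w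
  proof -
    have "f (w - (f w / f e) *\<^sub>R e) = 0" using fe by (simp add: diff scaleR)
    then have "e \<bullet> (w - (f w / f e) *\<^sub>R e) = 0" using s(2) e_def by blast
    then have "e \<bullet> w = (f w / f e) * (e \<bullet> e)" by (simp add: inner_simps)
    then show ?thesis using fe \<open>e \<noteq> 0\<close> by simp
  qed
  then show ?thesis by blast
next
  case True
  then have "\<forall>w. f w = 0 \<bullet> w" by simp
  then show ?thesis by (rule exI)
qed

section \<open>Weak sequential compactness of bounded sets\<close>

lemma weakly_converges_iff_inner:
  fixes l :: "'a::{real_inner, complete_space}"
  shows "weakly_converges x l \<longleftrightarrow> (\<forall>w. (\<lambda>n. w \<bullet> x n) \<longlonglongrightarrow> w \<bullet> l)"
proof
  show "\<forall>w. (\<lambda>n. w \<bullet> x n) \<longlonglongrightarrow> w \<bullet> l" if "weakly_converges x l"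
    using that[unfolded weakly_converges_def, rule_format, OF bounded_linear_inner_right] by blast
  show "weakly_converges x l" if inner: "\<forall>w. (\<lambda>n. w \<bullet> x n) \<longlonglongrightarrow> w \<bullet> l"
    unfolding weakly_converges_def
  proof (intro allI impI)
    fix f :: "'a \<Rightarrow> real" assume "bounded_linear f"
    then obtain y where "\<And>w. f w = y \<bullet> w" using riesz_representation by blast
    then show "(\<lambda>n. f (x n)) \<longlonglongrightarrow> f l" using inner by simp
  qed
qed

text \<open>No separability is assumed: it is enough to test against the sequence itself, because
  vectors orthogonal to its closed span see only zeros. The limit functional is then represented by
  Riesz.\<close>

lemma bounded_imp_weakly_convergent_subseq:
  fixes x :: "nat \<Rightarrow> 'a::{real_inner, complete_space}"
  assumes bound: "\<And>n. norm (x n) \<le> B"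
  shows "\<exists>l s. strict_mono (s :: nat \<Rightarrow> nat) \<and> weakly_converges (x \<circ> s) l"
proof -
  \<comment> \<open>The rows \<open>x n \<bullet> x m\<close> of the Gram matrix lie in a compact
    product of intervals, so Tychonoff replaces a diagonal argument.\<close>
  have "compactin (product_topology (\<lambda>_::nat. euclideanreal) UNIV) (PiE UNIV (\<lambda>m. {- (B * B)..B * B}))"
    unfolding compactin_PiE by simp
  then have "compact (PiE UNIV (\<lambda>m::nat. {- (B * B)..B * B}))"
    by (simp add: euclidean_product_topology)
  then have "seq_compact (PiE UNIV (\<lambda>m::nat. {- (B * B)..B * B}))" by (rule compact_imp_seq_compact)
  moreover have "\<forall>n. (\<lambda>m. x n \<bullet> x m) \<in> PiE UNIV (\<lambda>m::nat. {- (B * B)..B * B})"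
  proof -
    have "\<bar>x n \<bullet> x m\<bar> \<le> B * B" for n m
      using Cauchy_Schwarz_ineq2[of "x n" "x m"] mult_mono[OF bound[of n] bound[of m]]
      by (smt (verit) norm_ge_zero bound)
    then show ?thesis by (auto simp: abs_le_iff minus_le_iff)
  qed
  ultimately obtain g s where s: "strict_mono (s :: nat \<Rightarrow> nat)"
    and g: "((\<lambda>n m. x n \<bullet> x m) \<circ> s) \<longlonglongrightarrow> g"
    by (rule seq_compactE)
  define W where "W = {w. convergent (\<lambda>n. x (s n) \<bullet> w)}"
  have "x m \<in> W" for m
  proof -
    have "((\<lambda>f. f m) \<circ> ((\<lambda>n m. x n \<bullet> x m) \<circ> s)) \<longlonglongrightarrow> g m"
      unfolding comp_def
      by (rule continuous_on_tendsto_compose[OF continuous_on_product_coordinates[of m] g[unfolded comp_def]]) auto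
    then show ?thesis by (auto simp: W_def convergent_def comp_def)
  qed
  moreover have "subspace W"
    unfolding subspace_def W_def
    by (auto simp: inner_simps convergent_const intro: convergent_add convergent_mult)
  ultimately have span: "span (range x) \<subseteq> W" by (intro span_minimal) auto
  have clo: "w \<in> W" if w: "w \<in> closure (span (range x))" for w
  proof -
    have "Cauchy (\<lambda>n. x (s n) \<bullet> w)"
    proof (rule metric_CauchyI)
      fix e :: real assume e: "e > 0"
      have B0: "B \<ge> 0" using bound[of 0] by (smt (verit) norm_ge_zero)
      have "e / (4 * (B + 1)) > 0" using e B0 by simp
      then obtain w' where w': "w' \<in> span (range x)" "dist w' w < e / (4 * (B + 1))"
        using w[unfolded closure_approachable] by blast
      have "w' \<in> W" using span w'(1) by blast
      then have "Cauchy (\<lambda>n. x (s n) \<bullet> w')" by (simp add: W_def convergent_Cauchy)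
      then obtain M where M: "\<And>m n. m \<ge> M \<Longrightarrow> n \<ge> M \<Longrightarrow> dist (x (s m) \<bullet> w') (x (s n) \<bullet> w') < e / 2"
        using e metric_CauchyD[of "\<lambda>n. x (s n) \<bullet> w'" "e / 2"] by auto
      have close: "\<bar>x n \<bullet> w - x n \<bullet> w'\<bar> \<le> e / 4" for n
      proof -
        have "\<bar>x n \<bullet> (w - w')\<bar> \<le> norm (x n) * norm (w - w')" by (rule Cauchy_Schwarz_ineq2)
        also have "\<dots> \<le> (B + 1) * (e / (4 * (B + 1)))"
          using w'(2) bound[of n] B0 by (intro mult_mono) (auto simp: dist_norm norm_minus_commute)
        also have "\<dots> = e / 4" using B0 by (simp add: field_simps)
        finally show ?thesis by (simp add: inner_simps)
      qed
      have "dist (x (s m) \<bullet> w) (x (s n) \<bullet> w) < e" if "m \<ge> M" "n \<ge> M" for m n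
        using M[OF that] close[of "s m"] close[of "s n"] unfolding dist_real_def by linarith
      then show "\<exists>M. \<forall>m\<ge>M. \<forall>n\<ge>M. dist (x (s m) \<bullet> w) (x (s n) \<bullet> w) < e" by blast
    qed
    then show ?thesis by (simp add: W_def Cauchy_convergent)
  qed
  \<comment> \<open>Every \<open>w\<close> may be replaced by its orthogonal projection
    \<open>p\<close> onto the closed span, which leaves the inner products with the sequence
    unchanged.\<close>
  have "convergent (\<lambda>n. x (s n) \<bullet> w)" for w
  proof -
    obtain p where p: "p \<in> closure (span (range x))" "\<And>u. u \<in> closure (span (range x)) \<Longrightarrow> (w - p) \<bullet> u = 0"
      using closed_subspace_orthogonal_projection[of "closure (span (range x))" w]
        subspace_closure[of "span (range x)"] by auto
    have "x n \<in> closure (span (range x))" for n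
      using subsetD[OF closure_subset span_base[of "x n" "range x"]] by simp
    then have "x n \<bullet> w = x n \<bullet> p" for n
      using p(2)[of "x n"] by (simp add: inner_simps inner_commute)
    then show ?thesis using clo[OF p(1)] by (simp add: W_def)
  qed
  then have L: "(\<lambda>n. x (s n) \<bullet> w) \<longlonglongrightarrow> lim (\<lambda>n. x (s n) \<bullet> w)" for w by (simp add: convergent_LIMSEQ_iff)
  have "bounded_linear (\<lambda>w. lim (\<lambda>n. x (s n) \<bullet> w))"
  proof (rule bounded_linear_intro[of _ B])
    show "lim (\<lambda>n. x (s n) \<bullet> (v + w)) = lim (\<lambda>n. x (s n) \<bullet> v) + lim (\<lambda>n. x (s n) \<bullet> w)" for v w
      using tendsto_add[OF L[of v] L[of w]] by (simp add: limI inner_simps)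
    show "lim (\<lambda>n. x (s n) \<bullet> (c *\<^sub>R w)) = c *\<^sub>R lim (\<lambda>n. x (s n) \<bullet> w)" for c w
      using tendsto_mult[OF tendsto_const[of c] L[of w]] by (simp add: limI inner_simps)
    show "norm (lim (\<lambda>n. x (s n) \<bullet> w)) \<le> norm w * B" for w
    proof (rule LIMSEQ_le_const2[OF tendsto_norm[OF L]])
      have "norm (x (s n) \<bullet> w) \<le> norm w * B" for n
        using Cauchy_Schwarz_ineq2[of "x (s n)" w] mult_right_mono[OF bound[of "s n"], of "norm w"]
        by (simp add: mult.commute)
      then show "\<exists>N. \<forall>n\<ge>N. norm (x (s n) \<bullet> w) \<le> norm w * B" by blast
    qed
  qed
  then obtain l where l: "\<And>w. lim (\<lambda>n. x (s n) \<bullet> w) = l \<bullet> w" using riesz_representation by blast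
  then have "weakly_converges (x \<circ> s) l"
    unfolding weakly_converges_iff_inner using L by (simp add: inner_commute)
  with s show ?thesis by blast
qed

subsection \<open>Second-order quotients at a projection\<close>

text \<open>Cauchy criterion along a filter. The approximant may change with the tolerance; those
  for tolerances \<open>inverse (real (Suc k))\<close> form a Cauchy sequence.\<close>

lemma eventually_approx_imp_convergent:
  fixes f :: "'b \<Rightarrow> 'a::{real_normed_vector, complete_space}"
  assumes F: "F \<noteq> bot" and approx: "\<And>e. e > 0 \<Longrightarrow> \<exists>w. \<forall>\<^sub>F t in F. norm (f t - w) \<le> e"
  shows "\<exists>l. (f \<longlongrightarrow> l) F"
proof -
  have "\<forall>k. \<exists>w. \<forall>\<^sub>F t in F. norm (f t - w) \<le> inverse (real (Suc k))"
    using approx by simp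
  then obtain w where w: "\<And>k. \<forall>\<^sub>F t in F. norm (f t - w k) \<le> inverse (real (Suc k))" by metis
  have ww: "norm (w k - w m) \<le> inverse (real (Suc k)) + inverse (real (Suc m))" for k m
  proof -
    from eventually_conj[OF w[of k] w[of m]] obtain t
      where "norm (f t - w k) \<le> inverse (real (Suc k))" "norm (f t - w m) \<le> inverse (real (Suc m))"
      using eventually_happens'[OF F] by blast
    then show ?thesis
      using norm_triangle_ineq4[of "f t - w m" "f t - w k"] by simp
  qed
  have "Cauchy w"
  proof (rule CauchyI)
    fix e :: real assume "e > 0"
    then obtain N where N: "inverse (real (Suc N)) < e / 2"
      using reals_Archimedean[of "e / 2"] by auto
    have "norm (w m - w n) < e" if "m \<ge> N" "n \<ge> N" for m n
    proof -
      have "inverse (real (Suc m)) \<le> inverse (real (Suc N))" "inverse (real (Suc n)) \<le> inverse (real (Suc N))"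
        using that by (simp_all add: field_simps)
      then show ?thesis using ww[of m n] N by linarith
    qed
    then show "\<exists>M. \<forall>m\<ge>M. \<forall>n\<ge>M. norm (w m - w n) < e" by blast
  qed
  then obtain l where l: "w \<longlonglongrightarrow> l" using Cauchy_convergent convergent_def by blast
  have wl: "norm (w k - l) \<le> inverse (real (Suc k))" for k
  proof (rule LIMSEQ_le)
    show "(\<lambda>m. norm (w k - w m)) \<longlonglongrightarrow> norm (w k - l)" by (intro tendsto_intros l)
    have "(\<lambda>m. inverse (real (Suc k)) + inverse (real (Suc m))) \<longlonglongrightarrow> inverse (real (Suc k)) + 0"
      by (intro tendsto_add tendsto_const LIMSEQ_inverse_real_of_nat)
    then show "(\<lambda>m. inverse (real (Suc k)) + inverse (real (Suc m))) \<longlonglongrightarrow> inverse (real (Suc k))" by simp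
    show "\<exists>N. \<forall>n\<ge>N. norm (w k - w n) \<le> inverse (real (Suc k)) + inverse (real (Suc n))"
      using ww by blast
  qed
  have "(f \<longlongrightarrow> l) F"
  proof (rule tendstoI)
    fix e :: real assume "e > 0"
    then obtain k where k: "inverse (real (Suc k)) < e / 2"
      using reals_Archimedean[of "e / 2"] by auto
    show "\<forall>\<^sub>F t in F. dist (f t) l < e"
      using w[of k]
    proof eventually_elim
      case (elim t)
      then show ?case
        using norm_triangle_ineq[of "f t - w k" "w k - l"] wl[of k] k by (simp add: dist_norm)
    qed
  qed
  then show ?thesis by blast
qed

lemma pos_null_seq_imp_filterlim:
  "pos_null_seq t \<Longrightarrow> filterlim t (at_right 0) sequentially"
  unfolding pos_null_seq_def filterlim_at
  by (auto intro!: always_eventually simp: order.strict_implies_not_eq[THEN not_sym])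

lemma eventually_at_right_0_pos_null_seqI:
  assumes "\<And>t. pos_null_seq t \<Longrightarrow> \<forall>\<^sub>F n in sequentially. P (t n)"
  shows "\<forall>\<^sub>F s in at_right (0::real). P s"
  by (rule sequentially_imp_eventually_at_right[of 0 1]) (auto intro: assms simp: pos_null_seq_def)

lemma strongly_imp_weakly_converges: "zs \<longlonglongrightarrow> z \<Longrightarrow> weakly_converges zs z"
  unfolding weakly_converges_def by (auto intro: bounded_linear.tendsto)

text \<open>Closed form, for \<open>x\<close> in \<open>K\<close> and \<open>t > 0\<close>, of the
  second-order quotient of \<open>half_sq_on K\<close> at \<open>x\<close> for \<open>x + v\<close>:
  the part \<open>x\<close> of the functional cancels the linear term of the squared norm.\<close>

definition epi_quot :: "'a::real_inner set \<Rightarrow> 'a \<Rightarrow> 'a \<Rightarrow> real \<Rightarrow> 'a \<Rightarrow> ereal" where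
  "epi_quot K x v t z = (if x + t *\<^sub>R z \<in> K then ereal ((norm z)\<^sup>2 - 2 * (v \<bullet> z) / t) else \<infinity>)"

definition half_sq_on :: "'a::real_inner set \<Rightarrow> 'a \<Rightarrow> ereal" where
  "half_sq_on K = (\<lambda>x. ereal (1 / 2 * (norm x)\<^sup>2) + indicator_fun K x)"

abbreviation epi_sub :: "'a::real_inner set \<Rightarrow> 'a \<Rightarrow> 'a \<Rightarrow> 'a \<Rightarrow> ereal" where
  "epi_sub K x v \<equiv> second_subderivative (half_sq_on K) x (x + v)"

abbreviation epi_diff :: "'a::real_inner set \<Rightarrow> 'a \<Rightarrow> 'a \<Rightarrow> bool" where
  "epi_diff K x v \<equiv> strongly_twice_epi_differentiable (half_sq_on K) x (x + v)"

lemma second_diff_quot_half_sq_on: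
  assumes "x \<in> K" "t > 0"
  shows "second_diff_quot (half_sq_on K) x (x + v) t z = epi_quot K x v t z"
proof (cases "x + t *\<^sub>R z \<in> K")
  case True
  have "(norm (x + t *\<^sub>R z))\<^sup>2 / 2 - (norm x)\<^sup>2 / 2 - t * ((x + v) \<bullet> z)
    = (t\<^sup>2 / 2) * ((norm z)\<^sup>2 - 2 * (v \<bullet> z) / t)"
    unfolding power2_norm_eq_inner using assms(2)
    by (simp add: inner_simps inner_commute power2_eq_square field_simps)
  then show ?thesis
    using True assms by (simp add: second_diff_quot_def epi_quot_def half_sq_on_def indicator_fun_def)
next
  case False
  then show ?thesis
    using assms by (simp add: second_diff_quot_def epi_quot_def half_sq_on_def indicator_fun_def)
qed

lemma epi_sub_le:
  assumes "x \<in> K" "pos_null_seq t" "weakly_converges zs z"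
  shows "epi_sub K x v z \<le> liminf (\<lambda>n. epi_quot K x v (t n) (zs n))"
proof -
  have "(\<lambda>n. epi_quot K x v (t n) (zs n)) = (\<lambda>n. second_diff_quot (half_sq_on K) x (x + v) (t n) (zs n))"
    using assms(1,2) by (simp add: second_diff_quot_half_sq_on pos_null_seq_def)
  then show ?thesis unfolding second_subderivative_def using assms(2,3) by (auto intro: Inf_lower)
qed

lemma epi_sub_greatest:
  assumes "x \<in> K"
    "\<And>t zs. pos_null_seq t \<Longrightarrow> weakly_converges zs z \<Longrightarrow> c \<le> liminf (\<lambda>n. epi_quot K x v (t n) (zs n))"
  shows "c \<le> epi_sub K x v z"
proof -
  have "(\<lambda>n. second_diff_quot (half_sq_on K) x (x + v) (t n) (zs n)) = (\<lambda>n. epi_quot K x v (t n) (zs n))"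
    if "pos_null_seq t" for t zs
    using assms(1) that by (simp add: second_diff_quot_half_sq_on pos_null_seq_def)
  then show ?thesis unfolding second_subderivative_def by (auto intro!: Inf_greatest simp: assms(2))
qed

lemma epi_diff_iff:
  assumes "x \<in> K"
  shows "epi_diff K x v \<longleftrightarrow> (\<forall>z t. pos_null_seq t \<longrightarrow>
    (\<exists>zs. zs \<longlonglongrightarrow> z \<and> (\<lambda>n. epi_quot K x v (t n) (zs n)) \<longlonglongrightarrow> epi_sub K x v z))"
proof -
  have "(\<lambda>n. second_diff_quot (half_sq_on K) x (x + v) (t n) (zs n)) = (\<lambda>n. epi_quot K x v (t n) (zs n))"
    if "pos_null_seq t" for t zs
    using assms(1) that by (simp add: second_diff_quot_half_sq_on pos_null_seq_def)
  then show ?thesis unfolding strongly_twice_epi_differentiable_def by simp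
qed

text \<open>Affine functions are weakly continuous, so affine minorants of the quotients survive the
  weak limits in the second subderivative, even when their constants vary with
  \<open>t\<close>.\<close>

lemma epi_sub_ge_affine:
  assumes x: "x \<in> K"
    and minorant: "\<forall>\<^sub>F t in at_right 0. \<forall>z. ereal (2 * (q \<bullet> z) + a t) \<le> epi_quot K x v t z"
    and a: "(a \<longlongrightarrow> a0) (at_right 0)"
  shows "ereal (2 * (q \<bullet> z) + a0) \<le> epi_sub K x v z"
proof (rule epi_sub_greatest[OF x])
  fix t zs assume t: "pos_null_seq t" and zs: "weakly_converges zs z"
  have "(\<lambda>n. q \<bullet> zs n) \<longlonglongrightarrow> q \<bullet> z"
    using zs[unfolded weakly_converges_def, rule_format, OF bounded_linear_inner_right] .
  moreover have "(\<lambda>n. a (t n)) \<longlonglongrightarrow> a0"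
    using filterlim_compose[OF a pos_null_seq_imp_filterlim[OF t]] .
  ultimately have "(\<lambda>n. ereal (2 * (q \<bullet> zs n) + a (t n))) \<longlonglongrightarrow> ereal (2 * (q \<bullet> z) + a0)"
    by (intro tendsto_ereal tendsto_add tendsto_mult tendsto_const)
  then have "ereal (2 * (q \<bullet> z) + a0) = liminf (\<lambda>n. ereal (2 * (q \<bullet> zs n) + a (t n)))"
    by (rule lim_imp_Liminf[OF sequentially_bot, symmetric])
  also have "\<dots> \<le> liminf (\<lambda>n. epi_quot K x v (t n) (zs n))"
    using minorant filterlim_iff[THEN iffD1, OF pos_null_seq_imp_filterlim[OF t]]
    by (intro Liminf_mono) (auto elim!: eventually_mono dest!: spec)
  finally show "ereal (2 * (q \<bullet> z) + a0) \<le> liminf (\<lambda>n. epi_quot K x v (t n) (zs n))" .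
qed

section \<open>Difference quotients of the projection as minimisers\<close>

locale projection_base = prox_regular_set K r
  for K :: "'a::{real_inner, complete_space} set" and r :: real +
  fixes xb v :: 'a
  assumes base: "xb \<in> proj_set K (xb + v)" and v_less: "norm v < r"
begin

lemma xb_in: "xb \<in> K"
  using base by (simp add: proj_set_iff)

definition dq :: "real \<Rightarrow> 'a \<Rightarrow> 'a" where
  "dq t q = (proj K (xb + v + t *\<^sub>R q) - xb) /\<^sub>R t"

text \<open>Up to a constant, the squared distance from \<open>xb + t *\<^sub>R z\<close> to
  \<open>xb + v + t *\<^sub>R q\<close> divided by \<open>t\<^sup>2\<close>. The constraint of lying
  in \<open>K\<close> is kept apart so that values are real.\<close>

definition tilted :: "real \<Rightarrow> 'a \<Rightarrow> 'a \<Rightarrow> real" where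
  "tilted t q z = (norm z)\<^sup>2 - 2 * (v \<bullet> z) / t - 2 * (q \<bullet> z)"

lemma epi_quot_in: "xb + t *\<^sub>R z \<in> K \<Longrightarrow> epi_quot K xb v t z = ereal (tilted t q z + 2 * (q \<bullet> z))"
  by (simp add: epi_quot_def tilted_def)

lemma eventually_close:
  assumes "norm v < \<rho>"
  shows "\<forall>\<^sub>F t in at_right 0. t > 0 \<and> norm v + t * M < \<rho>"
proof -
  have "((\<lambda>t. norm v + t * M) \<longlongrightarrow> norm v + 0 * M) (at_right 0)"
    by (intro tendsto_intros)
  then have "\<forall>\<^sub>F t in at_right 0. norm v + t * M < \<rho>"
    by (rule order_tendstoD) (use assms in simp)
  then show ?thesis using eventually_at_right_less[of "0::real"] by eventually_elim simp
qed

lemma dq_in_proj_set: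
  assumes "t > 0" "norm v + t * norm q < r"
  shows "xb + t *\<^sub>R dq t q \<in> proj_set K (xb + v + t *\<^sub>R q)"
    and "norm ((xb + v + t *\<^sub>R q) - (xb + t *\<^sub>R dq t q)) \<le> norm v + t * norm q"
proof -
  have n: "norm (xb - (xb + v + t *\<^sub>R q)) \<le> norm v + t * norm q"
    using norm_triangle_ineq[of v "t *\<^sub>R q"] norm_minus_cancel[of "v + t *\<^sub>R q"] assms(1)
    by (simp add: algebra_simps)
  then have "xb + v + t *\<^sub>R q \<in> enlargement K r"
    unfolding enlargement_def using xb_in assms(2) by force
  moreover have "xb + t *\<^sub>R dq t q = proj K (xb + v + t *\<^sub>R q)" using assms(1) by (simp add: dq_def)
  ultimately show in_proj: "xb + t *\<^sub>R dq t q \<in> proj_set K (xb + v + t *\<^sub>R q)"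
    using proj_in_proj_set by simp
  then have "norm ((xb + t *\<^sub>R dq t q) - (xb + v + t *\<^sub>R q)) \<le> norm v + t * norm q"
    using n xb_in unfolding proj_set_iff by force
  then show "norm ((xb + v + t *\<^sub>R q) - (xb + t *\<^sub>R dq t q)) \<le> norm v + t * norm q"
    by (simp only: norm_minus_commute)
qed

lemma dq_in_K:
  assumes "t > 0" "norm v + t * norm q < r"
  shows "xb + t *\<^sub>R dq t q \<in> K"
  using dq_in_proj_set(1)[OF assms] by (simp add: proj_set_iff)

lemma dq_lipschitz:
  assumes "t > 0" "norm v + t * norm q \<le> \<rho>" "norm v + t * norm q' \<le> \<rho>" "\<rho> < r"
  shows "norm (dq t q - dq t q') \<le> r / (r - \<rho>) * norm (q - q')"
proof -
  have less: "norm v + t * norm q < r" "norm v + t * norm q' < r" using assms by auto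
  have "norm ((xb + t *\<^sub>R dq t q) - (xb + t *\<^sub>R dq t q'))
    \<le> r / (r - \<rho>) * norm ((xb + v + t *\<^sub>R q) - (xb + v + t *\<^sub>R q'))"
    using dq_in_proj_set[OF assms(1) less(1)] dq_in_proj_set[OF assms(1) less(2)] assms
    by (intro proj_set_lipschitz) auto
  moreover have "(xb + t *\<^sub>R dq t q) - (xb + t *\<^sub>R dq t q') = t *\<^sub>R (dq t q - dq t q')"
    "(xb + v + t *\<^sub>R q) - (xb + v + t *\<^sub>R q') = t *\<^sub>R (q - q')" by (simp_all add: algebra_simps)
  ultimately have "t * norm (dq t q - dq t q') \<le> t * (r / (r - \<rho>) * norm (q - q'))"
    using assms(1) by (simp add: mult.left_commute)
  then show ?thesis using assms(1) by (simp only: mult_le_cancel_left_pos)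
qed

lemma proj_base: "proj K (xb + v) = xb"
  using proj_eq[OF base] v_less by simp

lemma dq_zero [simp]: "dq t 0 = 0"
  by (simp add: dq_def proj_base)

text \<open>\<open>ray_quadratic_growth\<close> at the perturbed point with \<open>c = 1\<close>,
  rescaled by \<open>t\<^sup>2\<close>. The coefficient depends on \<open>\<rho>\<close> only, hence
  is uniform in small \<open>t\<close>.\<close>

lemma tilted_growth:
  assumes "t > 0" "norm v + t * norm q \<le> \<rho>" "\<rho> < r" "xb + t *\<^sub>R z \<in> K"
  shows "tilted t q (dq t q) + (1 - \<rho> / r) * (norm (z - dq t q))\<^sup>2 \<le> tilted t q z"
proof -
  have less: "norm v + t * norm q < r" using assms by auto
  have sq: "(norm ((xb + t *\<^sub>R w) - (xb + v + t *\<^sub>R q)))\<^sup>2 = t\<^sup>2 * tilted t q w + (norm (v + t *\<^sub>R q))\<^sup>2" for w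
    unfolding power2_norm_eq_inner tilted_def using assms(1)
    by (simp add: inner_simps inner_commute power2_eq_square field_simps)
  let ?x = "xb + t *\<^sub>R dq t q" and ?y = "xb + v + t *\<^sub>R q"
  have diff: "(xb + t *\<^sub>R z) - ?x = t *\<^sub>R (z - dq t q)" by (simp add: algebra_simps)
  have "\<rho> / r \<ge> norm (?y - ?x) / r"
    using dq_in_proj_set(2)[OF assms(1) less] assms(2) r_pos by (simp add: divide_right_mono)
  then have "(1 - \<rho> / r) * (norm ((xb + t *\<^sub>R z) - ?x))\<^sup>2 \<le> (1 - norm (?y - ?x) / r) * (norm ((xb + t *\<^sub>R z) - ?x))\<^sup>2"
    by (intro mult_right_mono) auto
  moreover have "(norm (?y - ?x))\<^sup>2 + (1 - norm (?y - ?x) / r) * (norm ((xb + t *\<^sub>R z) - ?x))\<^sup>2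
      \<le> (norm ((xb + t *\<^sub>R z) - ?y))\<^sup>2"
    using ray_quadratic_growth[OF dq_in_proj_set(1)[OF assms(1) less] assms(4), of 1]
    unfolding scaleR_one add_diff_cancel_left' diff_add_cancel by (simp add: add.commute)
  ultimately have "(norm (?x - ?y))\<^sup>2 + (1 - \<rho> / r) * (norm ((xb + t *\<^sub>R z) - ?x))\<^sup>2
      \<le> (norm ((xb + t *\<^sub>R z) - ?y))\<^sup>2"
    by (simp only: norm_minus_commute[of ?x ?y])
  then have "t\<^sup>2 * (tilted t q (dq t q) + (1 - \<rho> / r) * (norm (z - dq t q))\<^sup>2) \<le> t\<^sup>2 * tilted t q z"
    unfolding sq diff norm_scaleR power_mult_distrib by (simp add: algebra_simps)
  then show ?thesis using assms(1) by simp
qed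

lemma epi_quot_ge_sq:
  assumes "t > 0"
  shows "ereal ((1 - norm v / r) * (norm z)\<^sup>2) \<le> epi_quot K xb v t z"
proof (cases "xb + t *\<^sub>R z \<in> K")
  case True
  then show ?thesis
    \<comment> \<open>For \<open>q = 0\<close> the minimiser is \<open>0\<close>, with value
      \<open>0\<close>.\<close>
    using tilted_growth[OF assms _ v_less True, of 0] by (simp add: epi_quot_def tilted_def)
qed (simp add: epi_quot_def)

lemma dq_minimizes:
  assumes "t > 0" "norm v + t * norm q < r"
  shows "ereal (2 * (q \<bullet> z) + tilted t q (dq t q)) \<le> epi_quot K xb v t z"
proof (cases "xb + t *\<^sub>R z \<in> K")
  case True
  have "0 \<le> 1 - (norm v + t * norm q) / r" using assms r_pos by simp
  then show ?thesis
    using tilted_growth[OF assms(1) order_refl assms(2) True]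
    by (smt (verit) epi_quot_in[OF True] ereal_less_eq(3) mult_nonneg_nonneg zero_le_power2)
qed (simp add: epi_quot_def)

end

subsection \<open>Moving the base point along the normal ray\<close>

context projection_base
begin

text \<open>The Lipschitz bound is uniform in small \<open>t\<close>, so varying directions may be
  frozen at their limit; Hadamard differentiability thus reduces to convergence for fixed
  directions.\<close>

lemma dq_perturb:
  assumes qt: "(qt \<longlongrightarrow> q) (at_right 0)"
  shows "((\<lambda>t. dq t (qt t) - dq t q) \<longlongrightarrow> 0) (at_right 0)"
proof (rule Lim_null_comparison)
  define \<rho> where "\<rho> = (norm v + r) / 2"
  have \<rho>: "norm v < \<rho>" "\<rho> < r" using v_less by (auto simp: \<rho>_def)
  have "\<forall>\<^sub>F t in at_right 0. dist (qt t) q < 1" using qt by (rule tendstoD) simp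
  then show "\<forall>\<^sub>F t in at_right 0. norm (dq t (qt t) - dq t q) \<le> r / (r - \<rho>) * norm (qt t - q)"
    using eventually_close[OF \<rho>(1), of "norm q + 1"]
  proof eventually_elim
    case (elim t)
    have "norm (qt t) \<le> norm q + 1"
      using elim(1) norm_triangle_ineq2[of "qt t" q] by (simp add: dist_norm)
    then have "t * norm (qt t) \<le> t * (norm q + 1)" "t * norm q \<le> t * (norm q + 1)"
      using elim(2) by (auto intro: mult_left_mono)
    then have "norm v + t * norm (qt t) \<le> \<rho>" "norm v + t * norm q \<le> \<rho>"
      using elim(2) by linarith+
    then show ?case using elim(2) \<rho>(2) dq_lipschitz by blast
  qed
  have "((\<lambda>t. r / (r - \<rho>) * norm (qt t - q)) \<longlongrightarrow> r / (r - \<rho>) * norm (q - q)) (at_right 0)"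
    by (intro tendsto_intros qt)
  then show "((\<lambda>t. r / (r - \<rho>) * norm (qt t - q)) \<longlongrightarrow> 0) (at_right 0)" by simp
qed

lemma hadamard_iff_dq_converges:
  "hadamard_dir_differentiable (proj K) (xb + v) \<longleftrightarrow> (\<forall>q. \<exists>y. ((\<lambda>t. dq t q) \<longlongrightarrow> y) (at_right 0))"
proof
  assume H: "hadamard_dir_differentiable (proj K) (xb + v)"
  show "\<forall>q. \<exists>y. ((\<lambda>t. dq t q) \<longlongrightarrow> y) (at_right 0)"
  proof
    fix q
    obtain y where "\<And>qt. (qt \<longlongrightarrow> q) (at_right 0) \<Longrightarrow>
        ((\<lambda>t. (proj K (xb + v + t *\<^sub>R qt t) - proj K (xb + v)) /\<^sub>R t) \<longlongrightarrow> y) (at_right 0)"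
      using H unfolding hadamard_dir_differentiable_def by blast
    from this[of "\<lambda>_. q"] show "\<exists>y. ((\<lambda>t. dq t q) \<longlongrightarrow> y) (at_right 0)"
      by (auto simp: dq_def proj_base)
  qed
next
  assume D: "\<forall>q. \<exists>y. ((\<lambda>t. dq t q) \<longlongrightarrow> y) (at_right 0)"
  show "hadamard_dir_differentiable (proj K) (xb + v)"
    unfolding hadamard_dir_differentiable_def
  proof
    fix q
    obtain y where y: "((\<lambda>t. dq t q) \<longlongrightarrow> y) (at_right 0)" using D by blast
    have "((\<lambda>t. dq t (qt t)) \<longlongrightarrow> y) (at_right 0)" if "(qt \<longlongrightarrow> q) (at_right 0)" for qt
      using tendsto_add[OF dq_perturb[OF that] y] by simp
    then show "\<exists>y. \<forall>qt. (qt \<longlongrightarrow> q) (at_right 0) \<longrightarrow>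
        ((\<lambda>t. (proj K (xb + v + t *\<^sub>R qt t) - proj K (xb + v)) /\<^sub>R t) \<longlongrightarrow> y) (at_right 0)"
      by (auto simp: dq_def proj_base)
  qed
qed

lemma dq_limit_lipschitz:
  assumes "((\<lambda>t. dq t q) \<longlongrightarrow> y) (at_right 0)" "((\<lambda>t. dq t q') \<longlongrightarrow> y') (at_right 0)"
    "norm v < \<rho>" "\<rho> < r"
  shows "norm (y - y') \<le> r / (r - \<rho>) * norm (q - q')"
proof (rule tendsto_upperbound)
  show "((\<lambda>t. norm (dq t q - dq t q')) \<longlongrightarrow> norm (y - y')) (at_right 0)"
    by (intro tendsto_intros assms)
  show "\<forall>\<^sub>F t in at_right 0. norm (dq t q - dq t q') \<le> r / (r - \<rho>) * norm (q - q')"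
    using eventually_close[OF assms(3), of "norm q"] eventually_close[OF assms(3), of "norm q'"]
    by eventually_elim (use assms(4) in \<open>auto simp del: times_divide_eq_left intro!: dq_lipschitz\<close>)
qed simp

lemma base_scaled:
  assumes "0 \<le> c" "c * norm v < r"
  shows "projection_base K r xb (c *\<^sub>R v)"
proof unfold_locales
  show "xb \<in> proj_set K (xb + c *\<^sub>R v)"
    using proj_set_ray[OF base assms(1)] assms(2) by simp
  show "norm (c *\<^sub>R v) < r" using assms by simp
qed

text \<open>If \<open>x\<close> is the projection of \<open>y\<close>, then it is also that of \<open>x + c (y - x)\<close>. Hence the difference
  quotients at \<open>xb + c v\<close> in direction \<open>q'\<close> are those at \<open>xb + v\<close> in a direction \<open>q\<close> that
  approximately solves \<open>c q - (c - 1) D q = q'\<close>; by the Lipschitz estimate this equation is solvable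
  by Banach's fixed point theorem precisely because \<open>c \<parallel>v\<parallel> < r\<close>.\<close>

lemma dq_converges_scaled:
  assumes conv: "\<forall>q. \<exists>y. ((\<lambda>t. dq t q) \<longlongrightarrow> y) (at_right 0)" and c: "1 \<le> c" "c * norm v < r"
  shows "\<exists>y. ((\<lambda>t. projection_base.dq K xb (c *\<^sub>R v) t q') \<longlongrightarrow> y) (at_right 0)"
proof -
  interpret S: projection_base K r xb "c *\<^sub>R v" using base_scaled c by simp
  obtain D where D: "\<And>q. ((\<lambda>t. dq t q) \<longlongrightarrow> D q) (at_right 0)" using conv by metis
  \<comment> \<open>The bound \<open>\<rho> < r / c\<close> keeps points at distance below
    \<open>\<rho>\<close> from their projection within distance \<open>r\<close> after stretching by
    \<open>c\<close>, and it makes \<open>k < 1\<close> below.\<close>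
  define \<rho> where "\<rho> = (norm v + r / c) / 2"
  have "norm v < r / c" using c by (simp add: field_simps)
  then have \<rho>: "norm v < \<rho>" "\<rho> < r / c"
    using field_less_half_sum[of "norm v" "r / c"] gt_half_sum[of "norm v" "r / c"]
    by (simp_all add: \<rho>_def)
  have c\<rho>: "c * \<rho> < r" using \<rho>(2) c(1) by (simp add: field_simps)
  have "r / c \<le> r" using c(1) r_pos by (simp add: field_simps)
  then have \<rho>r: "\<rho> < r" using \<rho>(2) by simp
  define T where "T q = (1 / c) *\<^sub>R (q' + (c - 1) *\<^sub>R D q)" for q
  define k where "k = (c - 1) / c * (r / (r - \<rho>))"
  have "\<exists>!q. T q = q"
  proof (rule banach_fix_type[of k])
    show "0 \<le> k" using c \<rho>r r_pos by (simp add: k_def)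
    have "(c - 1) * r < c * (r - \<rho>)" using c\<rho> by (simp add: algebra_simps)
    then show "k < 1" using c \<rho>r by (simp add: k_def divide_less_eq)
    show "\<forall>x y. dist (T x) (T y) \<le> k * dist x y"
    proof (intro allI)
      fix x y
      have "T x - T y = ((c - 1) / c) *\<^sub>R (D x - D y)"
        by (simp add: T_def scaleR_diff_right scaleR_add_right)
      then have "dist (T x) (T y) = (c - 1) / c * norm (D x - D y)"
        using c(1) by (simp add: dist_norm)
      also have "\<dots> \<le> (c - 1) / c * (r / (r - \<rho>) * norm (x - y))"
        using c(1) by (intro mult_left_mono dq_limit_lipschitz[OF D D \<rho>(1) \<rho>r]) auto
      finally show "dist (T x) (T y) \<le> k * dist x y" by (simp add: k_def dist_norm mult.assoc)
    qed
  qed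
  then obtain q where "T q = q" by blast
  then have "c *\<^sub>R q = c *\<^sub>R T q" by simp
  then have q: "c *\<^sub>R q + (1 - c) *\<^sub>R D q = q'"
    using c(1) by (simp add: T_def algebra_simps)
  \<comment> \<open>With the actual quotient \<open>dq t q\<close> in place of its limit
    \<open>D q\<close>, the two projections coincide exactly.\<close>
  define qt where "qt t = c *\<^sub>R q + (1 - c) *\<^sub>R dq t q" for t
  have "(qt \<longlongrightarrow> c *\<^sub>R q + (1 - c) *\<^sub>R D q) (at_right 0)"
    unfolding qt_def by (intro tendsto_intros D)
  then have qt: "(qt \<longlongrightarrow> q') (at_right 0)" by (simp add: q)
  have "\<forall>\<^sub>F t in at_right 0. S.dq t (qt t) = dq t q"
    using eventually_close[OF \<rho>(1), of "norm q"]
  proof eventually_elim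
    case (elim t)
    define x y where "x = xb + t *\<^sub>R dq t q" and "y = xb + v + t *\<^sub>R q"
    have t: "t > 0" "norm v + t * norm q < r" using elim \<rho>r by auto
    have xy: "x \<in> proj_set K y" "norm (y - x) < \<rho>"
      using dq_in_proj_set[OF t] elim by (auto simp: x_def y_def)
    have "c * norm (y - x) \<le> c * \<rho>" using xy(2) c(1) by (intro mult_left_mono) auto
    then have "c * norm (y - x) < r" using c\<rho> by linarith
    then have "proj K (x + c *\<^sub>R (y - x)) = x"
      using proj_eq proj_set_ray[OF xy(1), of c] c(1) by simp
    moreover have "x + c *\<^sub>R (y - x) = xb + c *\<^sub>R v + t *\<^sub>R qt t"
      by (simp add: x_def y_def qt_def algebra_simps)
    ultimately have "S.dq t (qt t) = (x - xb) /\<^sub>R t" by (simp add: S.dq_def)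
    then show ?case using t(1) by (simp add: x_def)
  qed
  then have "((\<lambda>t. S.dq t (qt t)) \<longlongrightarrow> D q) (at_right 0)"
    using D[of q] by (simp add: tendsto_cong)
  from tendsto_diff[OF this S.dq_perturb[OF qt]] show ?thesis by auto
qed

lemma epi_quot_scaled:
  assumes "c > 0"
  shows "epi_quot K xb v t z
    = ereal (1 / c) * epi_quot K xb (c *\<^sub>R v) t z + ereal ((1 - 1 / c) * (norm z)\<^sup>2)"
  using assms by (simp add: epi_quot_def field_simps)

text \<open>The additional term \<open>(1 - 1 / c) * (norm z)\<^sup>2\<close> converges along strong
  recovery sequences. Along weak ones it is only lower semicontinuous, which suffices because
  \<open>c \<ge> 1\<close> makes its coefficient nonnegative.\<close>

lemma epi_diff_scaled:
  assumes c: "1 \<le> c" "c * norm v < r" and E: "epi_diff K xb (c *\<^sub>R v)"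
  shows "epi_diff K xb v"
proof -
  interpret S: projection_base K r xb "c *\<^sub>R v" using base_scaled c by simp
  let ?Q = "epi_sub K xb (c *\<^sub>R v)"
  define R where "R z = ereal (1 / c) * ?Q z + ereal ((1 - 1 / c) * (norm z)\<^sup>2)" for z
  have quot: "epi_quot K xb v t z
      = ereal (1 / c) * epi_quot K xb (c *\<^sub>R v) t z + ereal ((1 - 1 / c) * (norm z)\<^sup>2)" for t z
    using c(1) by (intro epi_quot_scaled) simp
  have recovery: "\<exists>zs. zs \<longlonglongrightarrow> z \<and> (\<lambda>n. epi_quot K xb v (t n) (zs n)) \<longlonglongrightarrow> R z"
    if "pos_null_seq t" for t z
  proof -
    obtain zs where zs: "zs \<longlonglongrightarrow> z" "(\<lambda>n. epi_quot K xb (c *\<^sub>R v) (t n) (zs n)) \<longlonglongrightarrow> ?Q z"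
      using E[unfolded epi_diff_iff[OF xb_in]] \<open>pos_null_seq t\<close> by blast
    have "(\<lambda>n. ereal ((1 - 1 / c) * (norm (zs n))\<^sup>2)) \<longlonglongrightarrow> ereal ((1 - 1 / c) * (norm z)\<^sup>2)"
      by (intro tendsto_ereal tendsto_intros zs)
    then have "(\<lambda>n. epi_quot K xb v (t n) (zs n)) \<longlonglongrightarrow> R z"
      unfolding quot R_def
      by (intro tendsto_add_ereal_general1 tendsto_cmult_ereal zs) auto
    with zs(1) show ?thesis by blast
  qed
  have "R z = epi_sub K xb v z" for z
  proof (rule antisym)
    have t: "pos_null_seq (\<lambda>n. inverse (real (Suc n)))"
      unfolding pos_null_seq_def using LIMSEQ_inverse_real_of_nat by simp
    obtain zs where "zs \<longlonglongrightarrow> z" "(\<lambda>n. epi_quot K xb v (inverse (real (Suc n))) (zs n)) \<longlonglongrightarrow> R z"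
      using recovery[OF t] by blast
    then show "epi_sub K xb v z \<le> R z"
      using epi_sub_le[OF xb_in t strongly_imp_weakly_converges] lim_imp_Liminf sequentially_bot by metis
    show "R z \<le> epi_sub K xb v z"
    proof (rule epi_sub_greatest[OF xb_in])
      fix t zs assume t: "pos_null_seq t" and zs: "weakly_converges zs z"
      let ?A = "\<lambda>n. ereal (1 / c) * epi_quot K xb (c *\<^sub>R v) (t n) (zs n)"
      let ?B = "\<lambda>n. ereal ((1 - 1 / c) * (norm (zs n))\<^sup>2)"
      have c0: "0 \<le> 1 - 1 / c" using c(1) by simp
      have "(\<lambda>n. z \<bullet> zs n) \<longlonglongrightarrow> z \<bullet> z"
        using zs[unfolded weakly_converges_def, rule_format, OF bounded_linear_inner_right] .
      \<comment> \<open>The tangent of the squared norm at \<open>z\<close> is weakly continuous and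
        lies below it; this replaces weak convergence of the norms.\<close>
      then have "(\<lambda>n. ereal ((1 - 1 / c) * (2 * (z \<bullet> zs n) - (norm z)\<^sup>2)))
          \<longlonglongrightarrow> ereal ((1 - 1 / c) * (2 * (z \<bullet> z) - (norm z)\<^sup>2))"
        by (intro tendsto_ereal tendsto_mult tendsto_diff tendsto_const)
      then have "ereal ((1 - 1 / c) * (norm z)\<^sup>2)
          = liminf (\<lambda>n. ereal ((1 - 1 / c) * (2 * (z \<bullet> zs n) - (norm z)\<^sup>2)))"
        unfolding power2_norm_eq_inner by (subst lim_imp_Liminf[OF sequentially_bot]) auto
      also have "\<dots> \<le> liminf ?B"
      proof (intro Liminf_mono always_eventually allI)
        fix n
        have "0 \<le> (norm (zs n - z))\<^sup>2" by simp
        then have "2 * (z \<bullet> zs n) - (norm z)\<^sup>2 \<le> (norm (zs n))\<^sup>2"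
          unfolding power2_norm_eq_inner by (simp add: inner_simps inner_commute)
        then show "ereal ((1 - 1 / c) * (2 * (z \<bullet> zs n) - (norm z)\<^sup>2)) \<le> ?B n"
          using c0 by (simp add: mult_left_mono)
      qed
      finally have B: "ereal ((1 - 1 / c) * (norm z)\<^sup>2) \<le> liminf ?B" .
      have nonneg: "0 \<le> epi_quot K xb (c *\<^sub>R v) (t n) (zs n)" for n
      proof -
        have "0 \<le> (1 - norm (c *\<^sub>R v) / r) * (norm (zs n))\<^sup>2"
          using S.v_less r_pos by simp
        then have "0 \<le> ereal ((1 - norm (c *\<^sub>R v) / r) * (norm (zs n))\<^sup>2)" by simp
        also have "\<dots> \<le> epi_quot K xb (c *\<^sub>R v) (t n) (zs n)"
          using S.epi_quot_ge_sq t by (simp add: pos_null_seq_def)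
        finally show ?thesis .
      qed
      \<comment> \<open>Nonnegativity excludes sums of opposite infinities.\<close>
      have "0 \<le> liminf ?A" "0 \<le> liminf ?B"
        using nonneg c(1) c0 by (auto intro!: Liminf_bounded always_eventually)
      then have add: "liminf ?A + liminf ?B \<le> liminf (\<lambda>n. ?A n + ?B n)"
        by (intro ereal_liminf_add_mono) auto
      have "liminf ?A = ereal (1 / c) * liminf (\<lambda>n. epi_quot K xb (c *\<^sub>R v) (t n) (zs n))"
        using c(1) by (intro Liminf_ereal_mult_left) auto
      then have "ereal (1 / c) * ?Q z \<le> liminf ?A"
        using epi_sub_le[OF xb_in t zs] c(1) by (simp add: ereal_mult_left_mono)
      then have "R z \<le> liminf ?A + liminf ?B" unfolding R_def using B by (rule add_mono)
      with add show "R z \<le> liminf (\<lambda>n. epi_quot K xb v (t n) (zs n))" unfolding quot by simp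
    qed
  qed
  then show ?thesis unfolding epi_diff_iff[OF xb_in] using recovery by simp
qed

end

subsection \<open>From epi-differentiability to differentiability\<close>

context projection_base
begin

lemma dq_norm_le:
  assumes "t > 0" "norm v + t * norm q \<le> \<rho>" "\<rho> < r"
  shows "norm (dq t q) \<le> r / (r - \<rho>) * norm q"
proof -
  have "0 \<le> t * norm q" using assms(1) by simp
  then have "norm v \<le> \<rho>" using assms(2) by linarith
  then show ?thesis using dq_lipschitz[OF assms(1,2) _ assms(3), of 0] by simp
qed

lemma epi_sub_zero_le: "epi_sub K xb v 0 \<le> 0"
proof -
  have "pos_null_seq (\<lambda>n. inverse (real (Suc n)))"
    unfolding pos_null_seq_def using LIMSEQ_inverse_real_of_nat by simp
  from epi_sub_le[OF xb_in this strongly_imp_weakly_converges[OF tendsto_const], of v 0]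
  show ?thesis using xb_in by (simp add: epi_quot_def Liminf_const flip: zero_ereal_def)
qed

text \<open>Any almost minimiser \<open>w\<close> of \<open>epi_sub - 2 q\<close> has a recovery sequence, whose values are compared
  with those of the exact minimisers \<open>dq t q\<close> through quadratic growth. The missing lower bound on
  the minimal values comes from a weak cluster point of the minimisers.\<close>

lemma dq_converges_if_epi_diff:
  assumes E: "epi_diff K xb v"
  shows "\<exists>y. ((\<lambda>t. dq t q) \<longlongrightarrow> y) (at_right 0)"
proof (rule eventually_approx_imp_convergent)
  define \<rho> c where "\<rho> = (norm v + r) / 2" and "c = 1 - \<rho> / r"
  have \<rho>: "norm v < \<rho>" "\<rho> < r" using v_less by (auto simp: \<rho>_def)
  have c: "c > 0" using \<rho> r_pos by (simp add: c_def)
  define c0 where "c0 = 1 - norm v / r"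
  have c0: "c0 > 0" using v_less r_pos by (simp add: c0_def)
  \<comment> \<open>The real upper bounds of values of \<open>epi_sub - 2 q\<close>; the infimum
    \<open>M\<close> of \<open>V\<close> is the minimal value of the limit problem, bounded below by
    completing the square.\<close>
  define V where "V = {u. \<exists>z. epi_sub K xb v z \<le> ereal (2 * (q \<bullet> z) + u)}"
  have lower: "- ((norm q)\<^sup>2 / c0) \<le> u" if uV: "u \<in> V" for u
  proof -
    obtain z where z: "epi_sub K xb v z \<le> ereal (2 * (q \<bullet> z) + u)" using uV by (auto simp: V_def)
    have "ereal (2 * (q \<bullet> z) + - ((norm q)\<^sup>2 / c0)) \<le> epi_sub K xb v z"
    proof (rule epi_sub_ge_affine[OF xb_in _ tendsto_const])
      have "ereal (2 * (q \<bullet> z) + - ((norm q)\<^sup>2 / c0)) \<le> epi_quot K xb v t z" if "t > 0" for t z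
      proof -
        have "c0 * (2 * (q \<bullet> z) - (norm q)\<^sup>2 / c0) = 2 * (q \<bullet> (c0 *\<^sub>R z)) - (norm q)\<^sup>2"
          using c0 by (simp add: right_diff_distrib)
        also have "\<dots> \<le> (norm (c0 *\<^sub>R z))\<^sup>2"
        proof -
          have "0 \<le> (norm (c0 *\<^sub>R z - q))\<^sup>2" by simp
          then show ?thesis unfolding power2_norm_eq_inner by (simp add: inner_simps inner_commute)
        qed
        also have "\<dots> = c0 * (c0 * (norm z)\<^sup>2)" by (simp add: power_mult_distrib power2_eq_square)
        finally have "2 * (q \<bullet> z) - (norm q)\<^sup>2 / c0 \<le> c0 * (norm z)\<^sup>2"
          using c0 by (simp only: mult_le_cancel_left_pos)
        then show ?thesis
          using order_trans[OF _ epi_quot_ge_sq[OF that, of z]] by (simp add: c0_def)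
      qed
      then show "\<forall>\<^sub>F t in at_right 0. \<forall>z. ereal (2 * (q \<bullet> z) + - ((norm q)\<^sup>2 / c0)) \<le> epi_quot K xb v t z"
        using eventually_at_right_less[of "0::real"] by (auto elim: eventually_mono)
    qed
    from order_trans[OF this z] show ?thesis by simp
  qed
  then have bdd: "bdd_below V" by (rule bdd_belowI)
  have "0 \<in> V" using epi_sub_zero_le by (auto simp: V_def zero_ereal_def intro!: exI[of _ 0])
  define M where "M = Inf V"
  have M_le: "M \<le> u" if "u \<in> V" for u unfolding M_def using bdd that by (simp add: cInf_lower)
  fix e :: real assume "e > 0"
  \<comment> \<open>The gap between the recovery values and the minimal values will be at most
    \<open>3 * \<epsilon>\<close>; quadratic growth turns it into a distance of at most
    \<open>2 * e / 3\<close>, leaving \<open>e / 3\<close> for the recovery sequence.\<close>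
  define \<epsilon> where "\<epsilon> = c * (e / 3)\<^sup>2"
  have \<epsilon>: "\<epsilon> > 0" using c \<open>e > 0\<close> by (simp add: \<epsilon>_def)
  obtain u where u: "u \<in> V" "u < M + \<epsilon>"
    using cInf_lessD[of V "M + \<epsilon>"] \<open>0 \<in> V\<close> \<epsilon> by (auto simp: M_def)
  then obtain w where w: "epi_sub K xb v w \<le> ereal (2 * (q \<bullet> w) + u)" by (auto simp: V_def)
  have "\<forall>\<^sub>F n in sequentially. norm (dq (t n) q - w) \<le> e" if t: "pos_null_seq t" for t
  proof -
    have close: "\<forall>\<^sub>F n in sequentially. norm v + t n * norm q < \<rho>"
      using filterlim_iff[THEN iffD1, OF pos_null_seq_imp_filterlim[OF t], rule_format,
          OF eventually_close[OF \<rho>(1), of "norm q"]]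
      by eventually_elim simp
    \<comment> \<open>Otherwise a subsequence of minimisers has values below
      \<open>M - \<epsilon>\<close> and, being bounded, a weak cluster point, which puts
      \<open>M - \<epsilon>\<close> into \<open>V\<close>. The guard stays inside the statement so
      that its negation also supplies the bound on the minimisers.\<close>
    have min_ge: "\<forall>\<^sub>F n in sequentially. norm v + t n * norm q < \<rho> \<longrightarrow> M - \<epsilon> \<le> tilted (t n) q (dq (t n) q)"
    proof (rule ccontr)
      assume neg: "\<not> ?thesis"
      from not_eventually_sequentiallyD[OF neg] obtain k :: "nat \<Rightarrow> nat" where k: "strict_mono k"
        and "\<forall>n. \<not> (norm v + t (k n) * norm q < \<rho> \<longrightarrow> M - \<epsilon> \<le> tilted (t (k n)) q (dq (t (k n)) q))"
        by blast
      then have bad: "norm v + t (k n) * norm q < \<rho>" "tilted (t (k n)) q (dq (t (k n)) q) < M - \<epsilon>" for n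
        by (auto simp: not_le)
      have tpos: "t n > 0" for n using t by (simp add: pos_null_seq_def)
      obtain l s where s: "strict_mono (s :: nat \<Rightarrow> nat)"
        and l: "weakly_converges ((\<lambda>n. dq (t (k n)) q) \<circ> s) l"
        using bounded_imp_weakly_convergent_subseq[of "\<lambda>n. dq (t (k n)) q"]
          dq_norm_le[OF tpos less_imp_le[OF bad(1)] \<rho>(2)] by blast
      define T Z where "T n = t (k (s n))" and "Z n = dq (T n) q" for n
      have T: "pos_null_seq T"
        using LIMSEQ_subseq_LIMSEQ[of t 0 "k \<circ> s"] strict_mono_o[OF k s] t
        by (auto simp: pos_null_seq_def T_def[abs_def] comp_def)
      have Z: "weakly_converges Z l" using l by (simp add: Z_def[abs_def] T_def comp_def)
      have val: "epi_quot K xb v (T n) (Z n) \<le> ereal (2 * (q \<bullet> Z n) + (M - \<epsilon>))" for n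
      proof -
        have "xb + T n *\<^sub>R Z n \<in> K"
          unfolding T_def Z_def using bad(1)[of "s n"] \<rho> by (intro dq_in_K tpos) auto
        then show ?thesis
          using bad(2)[of "s n", folded T_def, folded Z_def] by (simp add: epi_quot_in[where q = q])
      qed
      have "(\<lambda>n. q \<bullet> Z n) \<longlonglongrightarrow> q \<bullet> l"
        using Z[unfolded weakly_converges_def, rule_format, OF bounded_linear_inner_right] .
      then have "(\<lambda>n. ereal (2 * (q \<bullet> Z n) + (M - \<epsilon>))) \<longlonglongrightarrow> ereal (2 * (q \<bullet> l) + (M - \<epsilon>))"
        by (intro tendsto_ereal tendsto_add tendsto_mult tendsto_const)
      then have "liminf (\<lambda>n. ereal (2 * (q \<bullet> Z n) + (M - \<epsilon>))) = ereal (2 * (q \<bullet> l) + (M - \<epsilon>))"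
        by (rule lim_imp_Liminf[OF sequentially_bot])
      moreover have "epi_sub K xb v l \<le> liminf (\<lambda>n. ereal (2 * (q \<bullet> Z n) + (M - \<epsilon>)))"
        by (rule order_trans[OF epi_sub_le[OF xb_in T Z]]) (intro Liminf_mono always_eventually allI val)
      ultimately have "M - \<epsilon> \<in> V" by (auto simp: V_def)
      then show False using M_le[of "M - \<epsilon>"] \<epsilon> by simp
    qed
    obtain zs where zs: "zs \<longlonglongrightarrow> w" "(\<lambda>n. epi_quot K xb v (t n) (zs n)) \<longlonglongrightarrow> epi_sub K xb v w"
      using E[unfolded epi_diff_iff[OF xb_in]] t by blast
    have "epi_sub K xb v w < ereal (2 * (q \<bullet> w) + M + \<epsilon>)"
      using w u(2) by (auto intro: le_less_trans)
    then have ev1: "\<forall>\<^sub>F n in sequentially. epi_quot K xb v (t n) (zs n) < ereal (2 * (q \<bullet> w) + M + \<epsilon>)"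
      by (rule order_tendstoD(2)[OF zs(2)])
    have "(\<lambda>n. 2 * (q \<bullet> zs n)) \<longlonglongrightarrow> 2 * (q \<bullet> w)" by (intro tendsto_intros zs)
    then have ev2: "\<forall>\<^sub>F n in sequentially. 2 * (q \<bullet> w) - \<epsilon> < 2 * (q \<bullet> zs n)"
      by (rule order_tendstoD) (use \<epsilon> in simp)
    have ev3: "\<forall>\<^sub>F n in sequentially. dist (zs n) w < e / 3"
      using zs(1) by (rule tendstoD) (use \<open>e > 0\<close> in simp)
    show ?thesis
      using close min_ge ev1 ev2 ev3
    proof eventually_elim
      case (elim n)
      have t0: "t n > 0" using t by (simp add: pos_null_seq_def)
      have zK: "xb + t n *\<^sub>R zs n \<in> K" using elim(3) by (auto simp: epi_quot_def split: if_splits)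
      then have "tilted (t n) q (zs n) + 2 * (q \<bullet> zs n) < 2 * (q \<bullet> w) + M + \<epsilon>"
        using elim(3) by (simp add: epi_quot_in[where q = q])
      then have "tilted (t n) q (zs n) < M + 2 * \<epsilon>" using elim(4) by linarith
      moreover have "tilted (t n) q (dq (t n) q) + c * (norm (zs n - dq (t n) q))\<^sup>2 \<le> tilted (t n) q (zs n)"
        unfolding c_def using tilted_growth[OF t0 less_imp_le[OF elim(1)] \<rho>(2) zK] .
      ultimately have "c * (norm (zs n - dq (t n) q))\<^sup>2 \<le> 3 * \<epsilon>" using elim(1,2) by linarith
      also have "\<dots> \<le> c * (2 * e / 3)\<^sup>2" using c by (simp add: \<epsilon>_def power2_eq_square field_simps)
      finally have "(norm (zs n - dq (t n) q))\<^sup>2 \<le> (2 * e / 3)\<^sup>2" using c by simp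
      then have "norm (zs n - dq (t n) q) \<le> 2 * e / 3" by (rule power2_le_imp_le) (use \<open>e > 0\<close> in simp)
      then show "norm (dq (t n) q - w) \<le> e"
        using elim(5) norm_triangle_ineq[of "dq (t n) q - zs n" "zs n - w"]
        by (simp add: dist_norm norm_minus_commute)
    qed
  qed
  then show "\<exists>w. \<forall>\<^sub>F t in at_right 0. norm (dq t q - w) \<le> e"
    using eventually_at_right_0_pos_null_seqI[of "\<lambda>t. norm (dq t q - w) \<le> e"] by blast
qed simp

end

subsection \<open>From differentiability to epi-differentiability\<close>

text \<open>At index \<open>n\<close> the witness is taken for the largest attainable level
  \<open>k \<le> n\<close>; monotonicity makes it serve all lower levels.\<close>

lemma diagonal_choice:
  assumes ev: "\<And>k::nat. \<forall>\<^sub>F n in sequentially. \<exists>w. P k n w"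
    and mono: "\<And>k k' n w. k \<le> k' \<Longrightarrow> P k' n w \<Longrightarrow> P k n w"
  shows "\<exists>w. \<forall>k. \<forall>\<^sub>F n in sequentially. P k n (w n)"
proof -
  define A where "A n = {k. k \<le> n \<and> (\<exists>w. P k n w)}" for n
  define w where "w n = (SOME w. P (Max (A n)) n w)" for n
  have "\<forall>\<^sub>F n in sequentially. P k n (w n)" for k
    using ev[of k] eventually_ge_at_top[of k]
  proof eventually_elim
    case (elim n)
    have "finite (A n)" by (rule finite_subset[of _ "{..n}"]) (auto simp: A_def)
    moreover have "k \<in> A n" using elim by (simp add: A_def)
    ultimately have "Max (A n) \<in> A n" "k \<le> Max (A n)" by (auto intro: Max_in)
    then have "P (Max (A n)) n (w n)" unfolding w_def by (auto simp: A_def intro: someI_ex)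
    with \<open>k \<le> Max (A n)\<close> show ?case by (rule mono)
  qed
  then show ?thesis by blast
qed

text \<open>Telescoping yields the left Riemann sum above and the right one below; shifting the
  index between them costs only the end terms.\<close>

lemma sum_bounds_of_increments:
  fixes a d :: "nat \<Rightarrow> real"
  assumes "\<And>i. i < n \<Longrightarrow> a (Suc i) \<le> a i - c * d i"
    and "\<And>i. i < n \<Longrightarrow> a i \<le> a (Suc i) + c * d (Suc i)"
  shows "a n \<le> a 0 - c * (\<Sum>i<n. d i)"
    and "a 0 - c * (\<Sum>i<n. d i) - c * (d n - d 0) \<le> a n"
proof -
  have "a m \<le> a 0 - c * (\<Sum>i<m. d i) \<and> a 0 - c * (\<Sum>i<m. d i) - c * (d m - d 0) \<le> a m"
    if "m \<le> n" for m
    using that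
  proof (induction m)
    case (Suc m)
    then show ?case using assms[of m] by (simp add: algebra_simps)
  qed simp
  then show "a n \<le> a 0 - c * (\<Sum>i<n. d i)"
    and "a 0 - c * (\<Sum>i<n. d i) - c * (d n - d 0) \<le> a n" by auto
qed

text \<open>Think of \<open>m\<close> as concave with gradient \<open>-2 D\<close>, so that \<open>m q + 2 (q, D q)\<close> is the
  value of the conjugate at \<open>D q\<close>. The statement is that every point \<open>z\<close> where the conjugate is
  finite is approximated, together with its value, by points in the range of \<open>D\<close>; the witnesses are
  almost maximisers of the regularised dual functional \<open>m q + 2 (q, z) - \<delta> \<parallel>q\<parallel>\<^sup>2\<close>.\<close>

lemma conjugate_approximation:
  fixes m :: "'a::real_inner \<Rightarrow> real" and D :: "'a \<Rightarrow> 'a"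
  assumes grad: "\<And>q q'. m q' \<le> m q - 2 * ((q' - q) \<bullet> D q)"
    and lip: "\<And>q q'. norm (D q - D q') \<le> L * norm (q - q')" and L: "0 \<le> L"
    and bound: "\<And>q. 2 * (q \<bullet> z) + m q \<le> S" and e: "e > 0"
  shows "\<exists>q. norm (D q - z) < e \<and> m q + 2 * (q \<bullet> D q) < S + e"
proof -
  \<comment> \<open>\<open>C * \<delta>\<close> will bound the residual \<open>norm g\<close>, and
    \<open>B\<close> will bound \<open>\<delta> * (norm q)\<^sup>2\<close>.\<close>
  define C B where "C = sqrt (2 * L + 1)" and "B = S - m 0 + 1"
  have C: "C > 0" "C\<^sup>2 = 2 * L + 1" using L by (simp_all add: C_def)
  have B: "B > 0" using bound[of 0] by (simp add: B_def)
  have "((\<lambda>\<delta>. C * \<delta> + sqrt (\<delta> * B)) \<longlongrightarrow> C * 0 + sqrt (0 * B)) (at_right 0)"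
    by (intro tendsto_intros)
  then have ev1: "\<forall>\<^sub>F \<delta> in at_right 0. C * \<delta> + sqrt (\<delta> * B) < e"
    by (rule order_tendstoD) (use e in simp)
  have "((\<lambda>\<delta>. C\<^sup>2 * \<delta>) \<longlongrightarrow> C\<^sup>2 * 0) (at_right 0)"
    by (intro tendsto_intros)
  then have ev2: "\<forall>\<^sub>F \<delta> in at_right 0. C\<^sup>2 * \<delta> < e"
    by (rule order_tendstoD) (use e in simp)
  have ev3: "\<forall>\<^sub>F \<delta> in at_right (0::real). \<delta> \<in> {0<..<1}"
    by (rule eventually_at_right_real) simp
  obtain \<delta> where \<delta>: "C * \<delta> + sqrt (\<delta> * B) < e" "C\<^sup>2 * \<delta> < e" "0 < \<delta>" "\<delta> < 1"
    using eventually_happens'[OF _ eventually_conj[OF ev1 eventually_conj[OF ev2 ev3]]] by auto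
  define h where "h q = m q + 2 * (q \<bullet> z) - \<delta> * (norm q)\<^sup>2" for q
  have hS: "h q \<le> S" for q
  proof -
    have "0 \<le> \<delta> * (norm q)\<^sup>2" using \<delta>(3) by simp
    then show ?thesis using bound[of q] unfolding h_def by linarith
  qed
  then have bdd: "bdd_above (range h)" by (auto intro!: bdd_aboveI)
  obtain q where "(SUP q. h q) - \<delta>\<^sup>2 < h q"
    using less_cSupD[of "range h" "(SUP q. h q) - \<delta>\<^sup>2"] \<delta>(3) by auto
  then have q: "h q' \<le> h q + \<delta>\<^sup>2" for q' using cSUP_upper[OF UNIV_I bdd, of q'] by simp
  \<comment> \<open>Half the gradient of \<open>h\<close>, if \<open>-2 D\<close> is the gradient of
    \<open>m\<close>. An ascent step along it gains at most \<open>\<delta>\<^sup>2\<close>, which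
    forces \<open>g\<close> to be small.\<close>
  define g where "g = z - D q - \<delta> *\<^sub>R q"
  \<comment> \<open>The step length that maximises the guaranteed gain
    \<open>2 * \<tau> - (2 * L + \<delta>) * \<tau>\<^sup>2\<close>.\<close>
  define \<tau> where "\<tau> = 1 / (2 * L + \<delta>)"
  have Ld: "2 * L + \<delta> > 0" using L \<delta>(3) by simp
  have "2 * (g \<bullet> (\<tau> *\<^sub>R g)) - (2 * L + \<delta>) * (norm (\<tau> *\<^sub>R g))\<^sup>2 \<le> h (q + \<tau> *\<^sub>R g) - h q"
  proof -
    define b where "b = \<tau> *\<^sub>R g"
    have "m q \<le> m (q + b) + 2 * (b \<bullet> D (q + b))" using grad[of q "q + b"] by simp
    moreover have "b \<bullet> D (q + b) \<le> b \<bullet> D q + L * (norm b)\<^sup>2"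
    proof -
      have "b \<bullet> (D (q + b) - D q) \<le> norm b * (L * norm b)"
        using order_trans[OF norm_cauchy_schwarz mult_left_mono[OF lip[of "q + b" q]]] by simp
      then show ?thesis by (simp add: inner_simps power2_eq_square mult_ac)
    qed
    moreover have "h (q + b) - h q
      = m (q + b) - m q + 2 * (b \<bullet> z) - 2 * \<delta> * (q \<bullet> b) - \<delta> * (norm b)\<^sup>2"
      unfolding h_def power2_norm_eq_inner by (simp add: inner_simps inner_commute algebra_simps)
    moreover have "2 * (g \<bullet> b) = 2 * (b \<bullet> z) - 2 * (b \<bullet> D q) - 2 * \<delta> * (q \<bullet> b)"
      unfolding g_def by (simp add: inner_simps inner_commute algebra_simps)
    ultimately show ?thesis unfolding b_def[symmetric] by (simp add: distrib_right)
  qed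
  also have "h (q + \<tau> *\<^sub>R g) - h q \<le> \<delta>\<^sup>2" using q[of "q + \<tau> *\<^sub>R g"] by simp
  also have "2 * (g \<bullet> (\<tau> *\<^sub>R g)) - (2 * L + \<delta>) * (norm (\<tau> *\<^sub>R g))\<^sup>2
      = (2 * \<tau> - (2 * L + \<delta>) * \<tau>\<^sup>2) * (norm g)\<^sup>2"
    unfolding power2_norm_eq_inner by (simp add: power2_eq_square algebra_simps)
  also have "2 * \<tau> - (2 * L + \<delta>) * \<tau>\<^sup>2 = \<tau>" using Ld by (simp add: \<tau>_def power2_eq_square)
  finally have "(norm g)\<^sup>2 \<le> (2 * L + \<delta>) * \<delta>\<^sup>2"
    using Ld by (simp add: \<tau>_def field_simps)
  also have "\<dots> \<le> (C * \<delta>)\<^sup>2" using \<delta>(4) by (simp add: C(2) power_mult_distrib mult_right_mono)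
  finally have g: "norm g \<le> C * \<delta>" by (rule power2_le_imp_le) (use C \<delta> in simp)
  have "\<delta> * (norm q)\<^sup>2 \<le> B"
  proof -
    have "m 0 \<le> h q + \<delta>\<^sup>2" using q[of 0] by (simp add: h_def)
    moreover have "\<delta>\<^sup>2 \<le> 1" using \<delta> by (simp add: power_le_one)
    ultimately show ?thesis using bound[of q] by (simp add: h_def B_def)
  qed
  then have "\<delta> * (\<delta> * (norm q)\<^sup>2) \<le> \<delta> * B" using \<delta>(3) by (intro mult_left_mono) auto
  then have "(\<delta> * norm q)\<^sup>2 \<le> \<delta> * B" by (simp add: power2_eq_square mult_ac)
  then have dq: "\<delta> * norm q \<le> sqrt (\<delta> * B)" by (rule real_le_rsqrt)
  have Dz: "D q - z = - g - \<delta> *\<^sub>R q" by (simp add: g_def)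
  have "norm (D q - z) \<le> norm g + norm (\<delta> *\<^sub>R q)"
    unfolding Dz using norm_triangle_ineq4[of "- g" "\<delta> *\<^sub>R q"] by simp
  also have "\<dots> < e" using g dq \<delta> by simp
  finally have 1: "norm (D q - z) < e" .
  have "m q + 2 * (q \<bullet> D q) = m q + 2 * (q \<bullet> z) - 2 * (q \<bullet> g) - 2 * (\<delta> * (norm q)\<^sup>2)"
  proof -
    have "q \<bullet> D q = q \<bullet> z - q \<bullet> g - \<delta> * (norm q)\<^sup>2"
      unfolding g_def power2_norm_eq_inner by (simp add: inner_simps)
    then show ?thesis by simp
  qed
  also have "\<dots> \<le> S + 2 * (norm q * (C * \<delta>)) - 2 * (\<delta> * (norm q)\<^sup>2)"
  proof -
    have "- (q \<bullet> g) \<le> norm q * norm g"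
      using norm_cauchy_schwarz[of "- q" g] by simp
    also have "\<dots> \<le> norm q * (C * \<delta>)" using g by (rule mult_left_mono) simp
    finally show ?thesis using bound[of q] by simp
  qed
  \<comment> \<open>Completing the square: the leftover penalty pays for the residual term, however
    large \<open>q\<close> is.\<close>
  also have "\<dots> \<le> S + C\<^sup>2 * \<delta>"
  proof -
    have "(norm q - C)\<^sup>2 = (norm q)\<^sup>2 + C\<^sup>2 - 2 * (norm q * C)" by (simp add: power2_diff)
    then have "2 * (norm q * C) - 2 * (norm q)\<^sup>2 \<le> C\<^sup>2"
      using zero_le_power2[of "norm q - C"] zero_le_power2[of "norm q"] by linarith
    then have "\<delta> * (2 * (norm q * C) - 2 * (norm q)\<^sup>2) \<le> \<delta> * C\<^sup>2"
      using \<delta>(3) by (intro mult_left_mono) auto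
    then show ?thesis by (simp add: algebra_simps)
  qed
  also have "\<dots> < S + e" using \<delta>(2) by simp
  finally show ?thesis using 1 by blast
qed

section \<open>Convergence of minimal values and recovery sequences\<close>

context projection_base
begin

definition minval :: "real \<Rightarrow> 'a \<Rightarrow> real" where
  "minval t q = tilted t q (dq t q)"

text \<open>The minimiser for \<open>q\<close> competes in the problem for
  \<open>q'\<close>.\<close>

lemma minval_supergradient:
  assumes "t > 0" "norm v + t * norm q < r" "norm v + t * norm q' < r"
  shows "minval t q' \<le> minval t q - 2 * ((q' - q) \<bullet> dq t q)"
  using dq_minimizes[OF assms(1,3), of "dq t q"] epi_quot_in[OF dq_in_K[OF assms(1,2)], where q = q]
  by (simp add: minval_def inner_simps)

lemma minval_zero: "minval t 0 = 0"
  by (simp add: minval_def tilted_def)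

text \<open>Formally \<open>minval t\<close> has gradient \<open>-2 dq t\<close>; the Riemann sum of that gradient along the segment
  from \<open>0\<close> to \<open>q\<close> approximates \<open>minval t q\<close> uniformly in \<open>t\<close> and passes to the limit \<open>t \<rightarrow> 0\<close>.\<close>

lemma minval_riemann_sum:
  assumes t: "t > 0" "norm v + t * norm q \<le> \<rho>" "\<rho> < r" and n: "n > 0"
  shows "\<bar>minval t q - (- (2 / real n) * (\<Sum>i<n. q \<bullet> dq t ((real i / real n) *\<^sub>R q)))\<bar>
    \<le> 2 / real n * (r / (r - \<rho>) * (norm q)\<^sup>2)"
proof -
  define a d where "a i = minval t ((real i / real n) *\<^sub>R q)"
    and "d i = q \<bullet> dq t ((real i / real n) *\<^sub>R q)" for i :: nat
  have valid: "norm v + t * norm ((real i / real n) *\<^sub>R q) < r" if "i \<le> n" for i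
  proof -
    have "norm ((real i / real n) *\<^sub>R q) \<le> norm q"
      unfolding norm_scaleR using that n by (intro mult_left_le_one_le) auto
    then have "t * norm ((real i / real n) *\<^sub>R q) \<le> t * norm q"
      using t(1) by (intro mult_left_mono) auto
    then show ?thesis using t(2,3) by linarith
  qed
  have step: "(real (Suc i) / real n) *\<^sub>R q - (real i / real n) *\<^sub>R q = (1 / real n) *\<^sub>R q" for i
    unfolding scaleR_diff_left[symmetric] by (simp add: diff_divide_distrib[symmetric])
  have step': "(real i / real n) *\<^sub>R q - (real (Suc i) / real n) *\<^sub>R q = - ((1 / real n) *\<^sub>R q)" for i
    unfolding step[of i, symmetric] by simp
  have up: "a (Suc i) \<le> a i - 2 / real n * d i" if "i < n" for i
    using minval_supergradient[OF t(1) valid valid, of i "Suc i"] that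
    unfolding step by (simp add: a_def d_def)
  have low: "a i \<le> a (Suc i) + 2 / real n * d (Suc i)" if "i < n" for i
    using minval_supergradient[OF t(1) valid valid, of "Suc i" i] that
    unfolding step' by (simp add: a_def d_def)
  have an: "a n = minval t q" "a 0 = 0" "d n = q \<bullet> dq t q" "d 0 = 0"
    using n by (simp_all add: a_def d_def minval_zero)
  \<comment> \<open>Since \<open>d 0 = 0\<close>, this single end term is the gap between the two
    Riemann sums.\<close>
  have "q \<bullet> dq t q \<le> r / (r - \<rho>) * (norm q)\<^sup>2"
  proof -
    have "q \<bullet> dq t q \<le> norm q * norm (dq t q)" by (rule norm_cauchy_schwarz)
    also have "\<dots> \<le> norm q * (r / (r - \<rho>) * norm q)"
      using dq_norm_le[OF t] by (rule mult_left_mono) simp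
    finally show ?thesis by (simp add: power2_eq_square mult_ac)
  qed
  then have "2 / real n * (q \<bullet> dq t q) \<le> 2 / real n * (r / (r - \<rho>) * (norm q)\<^sup>2)"
    by (intro mult_left_mono) auto
  moreover have "a n \<le> - (2 / real n) * (\<Sum>i<n. d i)"
    "- (2 / real n) * (\<Sum>i<n. d i) - 2 / real n * (q \<bullet> dq t q) \<le> a n"
    using sum_bounds_of_increments[of n a "2 / real n" d] up low an by auto
  ultimately show ?thesis unfolding an(1)[symmetric] d_def[symmetric] by linarith
qed

text \<open>The mesh \<open>n\<close> is fixed by the tolerance before \<open>t\<close> tends to
  \<open>0\<close>, so only finitely many limits of \<open>dq\<close> are taken at a time.\<close>

lemma minval_converges:
  assumes "\<forall>q. \<exists>y. ((\<lambda>t. dq t q) \<longlongrightarrow> y) (at_right 0)"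
  shows "\<exists>m. ((\<lambda>t. minval t q) \<longlongrightarrow> m) (at_right 0)"
proof (rule eventually_approx_imp_convergent)
  obtain D where D: "\<And>q. ((\<lambda>t. dq t q) \<longlongrightarrow> D q) (at_right 0)" using assms by metis
  define \<rho> where "\<rho> = (norm v + r) / 2"
  have \<rho>: "norm v < \<rho>" "\<rho> < r" using v_less by (auto simp: \<rho>_def)
  fix e :: real assume "e > 0"
  define X where "X = r / (r - \<rho>) * (norm q)\<^sup>2"
  have X: "X \<ge> 0" using \<rho> r_pos by (simp add: X_def)
  obtain n where n: "n > 0" "2 / real n * X \<le> e / 2"
  proof -
    obtain k where k: "real k > 4 * X / e" using reals_Archimedean2 by blast
    have "real (Suc k) * e \<ge> 4 * X" using k \<open>e > 0\<close> by (simp add: field_simps)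
    then have "2 / real (Suc k) * X \<le> e / 2" by (simp add: field_simps)
    then show ?thesis using that[of "Suc k"] by simp
  qed
  define U where "U t = - (2 / real n) * (\<Sum>i<n. q \<bullet> dq t ((real i / real n) *\<^sub>R q))" for t
  define w where "w = - (2 / real n) * (\<Sum>i<n. q \<bullet> D ((real i / real n) *\<^sub>R q))"
  have "(U \<longlongrightarrow> w) (at_right 0)"
    unfolding U_def w_def by (intro tendsto_intros D)
  then have "\<forall>\<^sub>F t in at_right 0. dist (U t) w < e / 2"
    by (rule tendstoD) (use \<open>e > 0\<close> in simp)
  then have "\<forall>\<^sub>F t in at_right 0. norm (minval t q - w) \<le> e"
    using eventually_close[OF \<rho>(1), of "norm q"]
  proof eventually_elim
    case (elim t)
    have "\<bar>minval t q - U t\<bar> \<le> 2 / real n * X"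
      unfolding U_def X_def using elim \<rho> n(1) by (intro minval_riemann_sum) auto
    then show ?case using elim(1) n(2) unfolding dist_real_def real_norm_def by linarith
  qed
  then show "\<exists>w. \<forall>\<^sub>F t in at_right 0. norm (minval t q - w) \<le> e" by blast
qed simp

text \<open>The limits \<open>m\<close> give affine minorants of the second subderivative. Conjugate
  approximation provides points \<open>D q\<close> near \<open>z\<close> with almost the right
  value, the minimisers \<open>dq (t n) q\<close> realise them, and a diagonal choice yields the
  recovery sequence.\<close>

lemma epi_diff_if_dq_converges:
  assumes conv: "\<forall>q. \<exists>y. ((\<lambda>t. dq t q) \<longlongrightarrow> y) (at_right 0)"
  shows "epi_diff K xb v"
  unfolding epi_diff_iff[OF xb_in]
proof (intro allI impI)
  fix z t assume t: "pos_null_seq t"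
  obtain D where D: "\<And>q. ((\<lambda>t. dq t q) \<longlongrightarrow> D q) (at_right 0)" using conv by metis
  obtain m where m: "\<And>q. ((\<lambda>t. minval t q) \<longlongrightarrow> m q) (at_right 0)"
    using minval_converges[OF conv] by metis
  define \<rho> where "\<rho> = (norm v + r) / 2"
  have \<rho>: "norm v < \<rho>" "\<rho> < r" using v_less by (auto simp: \<rho>_def)
  let ?Q = "epi_sub K xb v z"
  have minorant: "ereal (2 * (q \<bullet> z) + m q) \<le> ?Q" for q
  proof (rule epi_sub_ge_affine[OF xb_in _ m])
    show "\<forall>\<^sub>F t in at_right 0. \<forall>z. ereal (2 * (q \<bullet> z) + minval t q) \<le> epi_quot K xb v t z"
      using eventually_close[OF v_less, of "norm q"]
      by eventually_elim (simp add: minval_def dq_minimizes)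
  qed
  have grad: "m q' \<le> m q - 2 * ((q' - q) \<bullet> D q)" for q q'
  proof (rule tendsto_le[OF _ _ m])
    show "((\<lambda>t. minval t q - 2 * ((q' - q) \<bullet> dq t q)) \<longlongrightarrow> m q - 2 * ((q' - q) \<bullet> D q)) (at_right 0)"
      by (intro tendsto_intros m D)
    show "\<forall>\<^sub>F t in at_right 0. minval t q' \<le> minval t q - 2 * ((q' - q) \<bullet> dq t q)"
      using eventually_close[OF v_less, of "norm q"] eventually_close[OF v_less, of "norm q'"]
      by eventually_elim (simp add: minval_supergradient)
  qed simp
  \<comment> \<open>Only closeness and an upper bound on the values are requested; the lower bound
    holds along any weakly convergent sequence by definition of the second subderivative.\<close>
  have "\<exists>zs. \<forall>k::nat. \<forall>\<^sub>F n in sequentially. norm (zs n - z) < inverse (real (Suc k))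
      \<and> epi_quot K xb v (t n) (zs n) \<le> ?Q + ereal (inverse (real (Suc k)))"
  proof (rule diagonal_choice)
    fix k k' n :: nat and w
    assume "k \<le> k'" and w: "norm (w - z) < inverse (real (Suc k'))
      \<and> epi_quot K xb v (t n) w \<le> ?Q + ereal (inverse (real (Suc k')))"
    then have le: "inverse (real (Suc k')) \<le> inverse (real (Suc k))" by (simp add: field_simps)
    then have "?Q + ereal (inverse (real (Suc k'))) \<le> ?Q + ereal (inverse (real (Suc k)))"
      by (intro add_left_mono) simp
    with w le show "norm (w - z) < inverse (real (Suc k))
      \<and> epi_quot K xb v (t n) w \<le> ?Q + ereal (inverse (real (Suc k)))"
      by (meson less_le_trans order_trans)
  next
    fix k :: nat
    show "\<forall>\<^sub>F n in sequentially. \<exists>w. norm (w - z) < inverse (real (Suc k))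
      \<and> epi_quot K xb v (t n) w \<le> ?Q + ereal (inverse (real (Suc k)))"
    proof (cases ?Q)
      case PInf
      then show ?thesis by (intro always_eventually allI exI[of _ z]) simp
    next
      case MInf
      then show ?thesis using minorant[of 0] by simp
    next
      case (real S)
      obtain q where q: "norm (D q - z) < inverse (real (Suc k))"
        "m q + 2 * (q \<bullet> D q) < S + inverse (real (Suc k))"
        using conjugate_approximation[of m D "r / (r - \<rho>)" z S "inverse (real (Suc k))"]
          grad dq_limit_lipschitz[OF D D \<rho>] minorant[unfolded real] \<rho> r_pos by auto
      have dq_t: "((\<lambda>n. dq (t n) q) \<longlongrightarrow> D q) sequentially"
        using filterlim_compose[OF D pos_null_seq_imp_filterlim[OF t]] .
      then have "((\<lambda>n. norm (dq (t n) q - z)) \<longlongrightarrow> norm (D q - z)) sequentially"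
        by (intro tendsto_intros)
      then have ev1: "\<forall>\<^sub>F n in sequentially. norm (dq (t n) q - z) < inverse (real (Suc k))"
        by (rule order_tendstoD) (rule q(1))
      have "((\<lambda>n. minval (t n) q) \<longlongrightarrow> m q) sequentially"
        using filterlim_compose[OF m pos_null_seq_imp_filterlim[OF t]] .
      then have "((\<lambda>n. minval (t n) q + 2 * (q \<bullet> dq (t n) q)) \<longlongrightarrow> m q + 2 * (q \<bullet> D q)) sequentially"
        using dq_t by (intro tendsto_intros)
      then have ev2: "\<forall>\<^sub>F n in sequentially. minval (t n) q + 2 * (q \<bullet> dq (t n) q) < S + inverse (real (Suc k))"
        by (rule order_tendstoD) (rule q(2))
      have ev3: "\<forall>\<^sub>F n in sequentially. t n > 0 \<and> norm v + t n * norm q < r"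
        using filterlim_iff[THEN iffD1, OF pos_null_seq_imp_filterlim[OF t], rule_format,
            OF eventually_close[OF v_less, of "norm q"]] .
      show ?thesis
        using ev1 ev2 ev3
      proof eventually_elim
        case (elim n)
        then have "epi_quot K xb v (t n) (dq (t n) q) = ereal (minval (t n) q + 2 * (q \<bullet> dq (t n) q))"
          by (simp add: epi_quot_in[where q = q] dq_in_K minval_def)
        then show ?case using elim by (intro exI[of _ "dq (t n) q"]) (simp add: real)
      qed
    qed
  qed
  then obtain zs where zs: "\<And>k::nat. \<forall>\<^sub>F n in sequentially. norm (zs n - z) < inverse (real (Suc k))
      \<and> epi_quot K xb v (t n) (zs n) \<le> ?Q + ereal (inverse (real (Suc k)))" by blast
  have "zs \<longlonglongrightarrow> z"
  proof (rule tendstoI)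
    fix e :: real assume "e > 0"
    then obtain k where "inverse (real (Suc k)) < e" using reals_Archimedean by blast
    with zs[of k] show "\<forall>\<^sub>F n in sequentially. dist (zs n) z < e"
      by (auto simp: dist_norm elim!: eventually_mono)
  qed
  moreover have "(\<lambda>n. epi_quot K xb v (t n) (zs n)) \<longlonglongrightarrow> ?Q"
  proof (rule order_tendstoI)
    fix b assume "b < ?Q"
    then have "b < liminf (\<lambda>n. epi_quot K xb v (t n) (zs n))"
      using epi_sub_le[OF xb_in t strongly_imp_weakly_converges[OF \<open>zs \<longlonglongrightarrow> z\<close>]] by (rule less_le_trans)
    then show "\<forall>\<^sub>F n in sequentially. b < epi_quot K xb v (t n) (zs n)" by (rule less_LiminfD)
  next
    fix b assume b: "?Q < b"
    have "?Q \<noteq> -\<infinity>" using minorant[of 0] by auto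
    then obtain S where S: "?Q = ereal S" using b by (cases ?Q) auto
    obtain k where k: "ereal (S + inverse (real (Suc k))) < b"
    proof (cases b)
      case (real b')
      then obtain k where "inverse (real (Suc k)) < b' - S"
        using reals_Archimedean[of "b' - S"] b S by auto
      then show ?thesis using that[of k] real by simp
    next
      case PInf
      then show ?thesis using that[of 0] by simp
    next
      case MInf
      then show ?thesis using b by simp
    qed
    from zs[of k] show "\<forall>\<^sub>F n in sequentially. epi_quot K xb v (t n) (zs n) < b"
      by eventually_elim (use k S in \<open>auto intro: le_less_trans\<close>)
  qed
  ultimately show "\<exists>zs. zs \<longlonglongrightarrow> z \<and> (\<lambda>n. epi_quot K xb v (t n) (zs n)) \<longlonglongrightarrow> ?Q" by blast
qed

section \<open>The equivalence for all admissible multiples of the normal\<close>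

lemma epi_diff_iff_hadamard:
  "epi_diff K xb v \<longleftrightarrow> hadamard_dir_differentiable (proj K) (xb + v)"
  unfolding hadamard_iff_dq_converges
  using epi_diff_if_dq_converges dq_converges_if_epi_diff by blast

lemma epi_diff_scaled_iff:
  assumes "1 \<le> c" "c * norm v < r"
  shows "epi_diff K xb (c *\<^sub>R v) \<longleftrightarrow> hadamard_dir_differentiable (proj K) (xb + v)"
proof
  assume "epi_diff K xb (c *\<^sub>R v)"
  then show "hadamard_dir_differentiable (proj K) (xb + v)"
    using epi_diff_scaled[OF assms] epi_diff_iff_hadamard by blast
next
  interpret S: projection_base K r xb "c *\<^sub>R v" using base_scaled assms by simp
  assume "hadamard_dir_differentiable (proj K) (xb + v)"
  then have "\<forall>q. \<exists>y. ((\<lambda>t. S.dq t q) \<longlongrightarrow> y) (at_right 0)"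
    unfolding hadamard_iff_dq_converges using dq_converges_scaled assms by blast
  then show "epi_diff K xb (c *\<^sub>R v)" by (rule S.epi_diff_if_dq_converges)
qed

end

theorem theorem5p8:
  fixes K :: "'a::{real_inner, complete_space} set"
    and r :: real
    and p0 xbar :: 'a
    and j :: "'a \<Rightarrow> ereal"
  assumes "closed K" and "K \<noteq> {}"
    and "r > 0" and "prox_regular r K"
    and "p0 \<in> enlargement K r"
    and "xbar = proj K p0"
    and "j = (\<lambda>x. ereal (1 / 2 * (norm x)\<^sup>2) + indicator_fun K x)"
  shows "((\<forall>\<rho>\<in>{norm (p0 - xbar)<..<r}.
             strongly_twice_epi_differentiable j xbar (p0 + (1 - \<rho> / r) *\<^sub>R (p0 - xbar)))
          \<longleftrightarrow>
          (\<exists>\<rho>\<in>{norm (p0 - xbar)<..<r}.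
             strongly_twice_epi_differentiable j xbar (p0 + (1 - \<rho> / r) *\<^sub>R (p0 - xbar))))
       \<and> ((\<exists>\<rho>\<in>{norm (p0 - xbar)<..<r}.
             strongly_twice_epi_differentiable j xbar (p0 + (1 - \<rho> / r) *\<^sub>R (p0 - xbar)))
          \<longleftrightarrow>
          hadamard_dir_differentiable (proj K) p0)"
proof -
  interpret prox_regular_set K r using assms(1-4) by unfold_locales
  define v where "v = p0 - xbar"
  have p0: "p0 = xbar + v" by (simp add: v_def)
  have xbar: "xbar \<in> proj_set K p0" using proj_in_proj_set[OF assms(5)] assms(6) by simp
  have v: "norm v < r" using proj_set_norm_less[OF xbar assms(5)] by (simp add: v_def)
  interpret projection_base K r xbar v
    using xbar v by unfold_locales (simp_all add: p0)
  have j: "j = half_sq_on K" by (simp add: assms(7) half_sq_on_def)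
  have iff: "strongly_twice_epi_differentiable j xbar (p0 + (1 - \<rho> / r) *\<^sub>R v)
      \<longleftrightarrow> hadamard_dir_differentiable (proj K) p0"
    if \<rho>: "\<rho> \<in> {norm v<..<r}" for \<rho>
  proof -
    \<comment> \<open>The coefficient arises because
      \<open>p0 + (1 - \<rho> / r) *\<^sub>R v\<close> is
      \<open>xbar + (2 - \<rho> / r) *\<^sub>R v\<close>.\<close>
    have c: "1 \<le> 2 - \<rho> / r" using \<rho> r_pos by simp
    have "(2 - \<rho> / r) * norm v \<le> (2 - \<rho> / r) * \<rho>" using \<rho> c by (intro mult_left_mono) auto
    also have "\<dots> < r"
    proof -
      have "0 < (r - \<rho>)\<^sup>2" using \<rho> by simp
      then have "(2 * r - \<rho>) * \<rho> < r * r" by (simp add: power2_eq_square algebra_simps)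
      then show ?thesis using r_pos by (simp add: field_simps)
    qed
    finally have "(2 - \<rho> / r) * norm v < r" .
    then have "epi_diff K xbar ((2 - \<rho> / r) *\<^sub>R v) \<longleftrightarrow> hadamard_dir_differentiable (proj K) p0"
      using epi_diff_scaled_iff[OF c] p0 by simp
    moreover have "p0 + (1 - \<rho> / r) *\<^sub>R v = xbar + (2 - \<rho> / r) *\<^sub>R v"
      by (simp add: p0 scaleR_diff_left scaleR_2)
    ultimately show ?thesis by (simp only: j)
  qed
  \<comment> \<open>A nonempty interval is needed to pass from all \<open>\<rho>\<close> to some
    \<open>\<rho>\<close>; the other implications follow since the criterion for each
    \<open>\<rho>\<close> is the same.\<close>
  have "\<exists>\<rho>. \<rho> \<in> {norm v<..<r}" using dense[OF v] by auto
  with iff show ?thesis unfolding v_def by blast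
qed

end
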